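(* Let $0\le\alpha<2$. Let $X_\alpha=C_1^{\alpha}[0,1]$ if $\alpha\notin\{0,1\}$, $X_0=C[0,1]$ and $X_1=C^1[0,1]$. There exists a dense $G_\delta$ set $\mathcal G$ in $X_\alpha$ such that for any $f\in\mathcal G$ and any $A\subseteq[0,1]$, if $f|_A$ is convex or concave, then $$\dim_H A\le\underline{\dim}_M A\le\max\{0,\alpha-1\}.$$
   Context: For $0<\alpha<1$, $C_1^{\alpha}[0,1]$ is the set of functions $f:[0,1]\to\mathbb R$ with $|f(x)-f(y)|\le|x-y|^{\alpha}$ for all $x,y\in[0,1]$, with the metric $\|f-g\|_0$, where $\|h\|_0=\sup_{x\in[0,1]}|h(x)|$. For $1<\alpha<2$, $C_1^{\alpha}[0,1]$ is the set of differentiable functions $f:[0,1]\to\mathbb R$ with $|f'(x)-f'(y)|\le|x-y|^{\alpha-1}$ for all $x,y\in[0,1]$, with the metric $\|f-g\|_1$, where $\|h\|_1=\max\{\|h\|_0,\|h'\|_0\}$. $C[0,1]$ is the space of continuous real functions with metric $\|f-g\|_0$, and $C^1[0,1]$ is the space of continuously differentiable real functions with metric $\|f-g\|_1$. For $A\subseteq[0,1]$, $f|_A$ is convex if for all $x_1<x_2<x_3$ in $A$ one has $\frac{f(x_2)-f(x_1)}{x_2-x_1}\le\frac{f(x_3)-f(x_2)}{x_3-x_2}$, and concave if the reverse inequality always holds. $\dim_H$ denotes Hausdorff dimension. For an integer $k\ge2$ let $\mathcal N_{k,\ell}(A)=\#\{j\in\mathbb Z: A\cap[\frac{j-1}{k^\ell},\frac{j}{k^\ell}]\ne\emptyset\}$.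 The lower Minkowski (box) dimension is $\underline{\dim}_M A=\liminf_{\ell\to\infty}\frac{\log\mathcal N_{k,\ell}(A)}{\ell\log k}$, which does not depend on $k$. *)

theory Defs
  imports "HOL-Analysis.Analysis"
begin

section \<open>Function spaces on the unit interval\<close>

text \<open>
  A function on the unit interval is an extensional function \<open>real \<Rightarrow> real\<close>, i.e. one with the
  fixed value \<open>undefined\<close> outside \<open>{0..1}\<close>, so that functions agreeing on \<open>{0..1}\<close> are equal.
  Derivatives are taken within \<open>{0..1}\<close>: they are one-sided at the endpoints and do not depend
  on the values outside the interval.
\<close>

definition deriv01 :: "(real \<Rightarrow> real) \<Rightarrow> real \<Rightarrow> real" where
  "deriv01 f x = vector_derivative f (at x within {0..1})"

definition norm0 :: "(real \<Rightarrow> real) \<Rightarrow> real" where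
  "norm0 h = (SUP x\<in>{0..1}. \<bar>h x\<bar>)"

definition norm1 :: "(real \<Rightarrow> real) \<Rightarrow> real" where
  "norm1 h = max (norm0 h) (norm0 (deriv01 h))"

definition C_space :: "(real \<Rightarrow> real) set" where
  "C_space = {f \<in> extensional {0..1}. continuous_on {0..1} f}"

definition C1_space :: "(real \<Rightarrow> real) set" where
  "C1_space = {f \<in> extensional {0..1}.
     f differentiable_on {0..1} \<and> continuous_on {0..1} (deriv01 f)}"

text \<open>The set \<open>C\<^sub>1\<^sup>\<alpha>[0,1]\<close>, meant for \<open>0 < \<alpha> < 1\<close> and for \<open>1 < \<alpha> < 2\<close>.\<close>

definition Holder_space :: "real \<Rightarrow> (real \<Rightarrow> real) set" where
  "Holder_space \<alpha> =
     (if \<alpha> < 1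
      then {f \<in> extensional {0..1}.
              \<forall>x\<in>{0..1}. \<forall>y\<in>{0..1}. \<bar>f x - f y\<bar> \<le> \<bar>x - y\<bar> powr \<alpha>}
      else {f \<in> extensional {0..1}. f differentiable_on {0..1} \<and>
              (\<forall>x\<in>{0..1}. \<forall>y\<in>{0..1}.
                 \<bar>deriv01 f x - deriv01 f y\<bar> \<le> \<bar>x - y\<bar> powr (\<alpha> - 1))})"

definition X_space :: "real \<Rightarrow> (real \<Rightarrow> real) set" where
  "X_space \<alpha> = (if \<alpha> = 0 then C_space else if \<alpha> = 1 then C1_space else Holder_space \<alpha>)"

text \<open>
  The locale \<open>Metric_space\<close> asks for nonnegativity and symmetry on the whole type, so, as for
  the sup metric \<open>fdist\<close> of the library, the value off the carrier is \<open>0\<close>.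
\<close>

definition X_dist :: "real \<Rightarrow> (real \<Rightarrow> real) \<Rightarrow> (real \<Rightarrow> real) \<Rightarrow> real" where
  "X_dist \<alpha> f g =
     (if f \<in> X_space \<alpha> \<and> g \<in> X_space \<alpha>
      then (if \<alpha> < 1 then norm0 (\<lambda>x. f x - g x) else norm1 (\<lambda>x. f x - g x))
      else 0)"

definition X_topology :: "real \<Rightarrow> (real \<Rightarrow> real) topology" where
  "X_topology \<alpha> = Metric_space.mtopology (X_space \<alpha>) (X_dist \<alpha>)"

lemma has_vector_derivative_deriv01: "f differentiable_on {0..1} \<Longrightarrow> x \<in> {0..1} \<Longrightarrow> (f has_vector_derivative deriv01 f x) (at x within {0..1})"
  unfolding deriv01_def differentiable_on_def by (simp add: vector_derivative_works[symmetric])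

lemma deriv01_eqI: assumes "(f has_vector_derivative D) (at x within {0..1})" "x \<in> {0..1::real}" shows "deriv01 f x = D"
  unfolding deriv01_def by (rule vector_derivative_within_closed_interval[OF _ assms(2,1)]) simp

lemma deriv01_diff: "f differentiable_on {0..1} \<Longrightarrow> g differentiable_on {0..1} \<Longrightarrow> x \<in> {0..1} \<Longrightarrow> deriv01 (\<lambda>x. f x - g x) x = deriv01 f x - deriv01 g x"
  by (intro deriv01_eqI has_vector_derivative_diff has_vector_derivative_deriv01)

lemma continuous_on_Holder: assumes "a > 0" "\<And>x y. x \<in> {0..1} \<Longrightarrow> y \<in> {0..1} \<Longrightarrow> \<bar>h x - h y\<bar> \<le> \<bar>x-y\<bar> powr a" shows "continuous_on {0..1::real} (h::real\<Rightarrow>real)"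
  unfolding continuous_on_iff
proof (intro ballI allI impI)
  fix x e :: real assume x: "x \<in> {0..1}" "0 < e"
  show "\<exists>d>0. \<forall>x'\<in>{0..1}. dist x' x < d \<longrightarrow> dist (h x') (h x) < e"
  proof (intro exI[of _ "e powr (1/a)"] conjI ballI impI)
    show "e powr (1/a) > 0" using x by simp
    fix y assume y: "y \<in> {0..1}" "dist y x < e powr (1/a)"
    have "\<bar>y-x\<bar> powr a < (e powr (1/a)) powr a" using y(2) assms(1) by (intro powr_less_mono2) (auto simp: dist_real_def)
    also have "\<dots> = e" using assms(1) x by (simp add: powr_powr)
    finally show "dist (h y) (h x) < e" using assms(2)[OF y(1) x(1)] by (simp add: dist_real_def)
  qed
qed

lemma X_space_continuous: assumes "0 \<le> \<alpha>" "f \<in> X_space \<alpha>" shows "continuous_on {0..1} f"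
proof (cases "\<alpha> < 1 \<and> \<alpha> \<noteq> 0")
  case True then show ?thesis using assms by (intro continuous_on_Holder[of \<alpha>]) (auto simp: X_space_def Holder_space_def)
next
  case False then show ?thesis using assms by (auto simp: X_space_def Holder_space_def C_space_def C1_space_def intro: differentiable_imp_continuous_on split: if_splits)
qed

lemma X_space_differentiable: "f \<in> X_space \<alpha> \<Longrightarrow> \<alpha> \<ge> 1 \<Longrightarrow> f differentiable_on {0..1}"
  by (auto simp: X_space_def Holder_space_def C_space_def C1_space_def split: if_splits)

lemma X_space_deriv_continuous: "f \<in> X_space \<alpha> \<Longrightarrow> \<alpha> \<ge> 1 \<Longrightarrow> continuous_on {0..1} (deriv01 f)"
  by (cases "\<alpha> = 1") (auto simp: X_space_def Holder_space_def C_space_def C1_space_def intro: continuous_on_Holder[of "\<alpha>-1"])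

lemma bdd_above_abs_image: "continuous_on {0..1} h \<Longrightarrow> bdd_above ((\<lambda>x. \<bar>h x\<bar>) ` {0..1::real})" for h :: "real \<Rightarrow> real"
  by (intro bounded_imp_bdd_above compact_imp_bounded compact_continuous_image continuous_intros) auto

lemma norm0_upper: "continuous_on {0..1} h \<Longrightarrow> x \<in> {0..1} \<Longrightarrow> \<bar>h x\<bar> \<le> norm0 h"
  unfolding norm0_def by (rule cSUP_upper[OF _ bdd_above_abs_image])

lemma norm0_least: "(\<And>x. x \<in> {0..1} \<Longrightarrow> \<bar>h x\<bar> \<le> c) \<Longrightarrow> norm0 h \<le> c"
  unfolding norm0_def by (rule cSUP_least) auto

lemma norm0_cong: "(\<And>x. x \<in> {0..1} \<Longrightarrow> \<bar>h x\<bar> = \<bar>k x\<bar>) \<Longrightarrow> norm0 h = norm0 k"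
  unfolding norm0_def by (simp cong: image_cong_simp)

lemma X_space_extensional: "f \<in> X_space \<alpha> \<Longrightarrow> f \<in> extensional {0..1}"
  by (auto simp: X_space_def Holder_space_def C_space_def C1_space_def split: if_splits)

lemma norm0_triangle: assumes "continuous_on {0..1} f" "continuous_on {0..1} g" "continuous_on {0..1} h"
  shows "norm0 (\<lambda>x. f x - h x) \<le> norm0 (\<lambda>x. f x - g x) + norm0 (\<lambda>x. g x - h x)"
proof (rule norm0_least)
  fix x :: real assume x: "x \<in> {0..1}"
  show "\<bar>f x - h x\<bar> \<le> norm0 (\<lambda>x. f x - g x) + norm0 (\<lambda>x. g x - h x)"
    using norm0_upper[OF continuous_on_diff[OF assms(1,2)] x] norm0_upper[OF continuous_on_diff[OF assms(2,3)] x] by linarith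
qed

lemma norm0_nonneg: "continuous_on {0..1} h \<Longrightarrow> 0 \<le> norm0 h" using norm0_upper[of h 0] by force

lemma X_dist_ge_1: assumes "1 \<le> \<alpha>" "f \<in> X_space \<alpha>" "g \<in> X_space \<alpha>"
  shows "X_dist \<alpha> f g = max (norm0 (\<lambda>x. f x - g x)) (norm0 (\<lambda>x. deriv01 f x - deriv01 g x))"
proof -
  have "norm0 (deriv01 (\<lambda>x. f x - g x)) = norm0 (\<lambda>x. deriv01 f x - deriv01 g x)"
    using assms by (intro norm0_cong) (simp add: deriv01_diff X_space_differentiable)
  then show ?thesis using assms by (simp add: X_dist_def norm1_def)
qed

lemma X_dist_less_1: assumes "\<alpha> < 1" "f \<in> X_space \<alpha>" "g \<in> X_space \<alpha>"
  shows "X_dist \<alpha> f g = norm0 (\<lambda>x. f x - g x)" using assms by (simp add: X_dist_def)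

lemma norm0_diff_commute: "norm0 (\<lambda>x. f x - g x) = norm0 (\<lambda>x. g x - f x)" by (rule norm0_cong) simp

lemma Metric_space_X: assumes a: "0 \<le> \<alpha>" shows "Metric_space (X_space \<alpha>) (X_dist \<alpha>)"
proof
  fix f g
  have nn: "norm0 (\<lambda>x. f x - g x) \<ge> 0" if "f \<in> X_space \<alpha>" "g \<in> X_space \<alpha>"
    using that a by (intro norm0_nonneg continuous_on_diff X_space_continuous)
  show "0 \<le> X_dist \<alpha> f g"
    using nn by (auto simp: X_dist_def norm1_def)
  show "X_dist \<alpha> f g = X_dist \<alpha> g f"
  proof (cases "f \<in> X_space \<alpha> \<and> g \<in> X_space \<alpha>")
    case True then show ?thesis
      by (cases "\<alpha> < 1") (simp_all add: X_dist_less_1 X_dist_ge_1 norm0_diff_commute[of f] norm0_diff_commute[of "deriv01 f"])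
  qed (auto simp: X_dist_def)
  assume f: "f \<in> X_space \<alpha>" and g: "g \<in> X_space \<alpha>"
  show "X_dist \<alpha> f g = 0 \<longleftrightarrow> f = g"
  proof
    assume "X_dist \<alpha> f g = 0"
    then have "norm0 (\<lambda>x. f x - g x) \<le> 0"
      using f g by (cases "\<alpha> < 1") (auto simp: X_dist_less_1 X_dist_ge_1)
    then have "f x = g x" if "x \<in> {0..1}" for x
      using norm0_upper[OF continuous_on_diff[OF X_space_continuous[OF a f] X_space_continuous[OF a g]] that] by simp
    then show "f = g" using X_space_extensional[OF f] X_space_extensional[OF g] by (intro extensionalityI) auto
  next
    assume "f = g" then show "X_dist \<alpha> f g = 0"
      using f by (cases "\<alpha> < 1") (simp_all add: X_dist_less_1 X_dist_ge_1 norm0_def)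
  qed
next
  fix f g h assume *: "f \<in> X_space \<alpha>" "g \<in> X_space \<alpha>" "h \<in> X_space \<alpha>"
  note t = norm0_triangle[OF *[THEN X_space_continuous[OF a]]]
  show "X_dist \<alpha> f h \<le> X_dist \<alpha> f g + X_dist \<alpha> g h"
  proof (cases "\<alpha> < 1")
    case True then show ?thesis using * t by (simp add: X_dist_less_1)
  next
    case False
    then have "1 \<le> \<alpha>" by simp
    from norm0_triangle[OF *[THEN X_space_deriv_continuous[OF _ this]]] t show ?thesis unfolding X_dist_ge_1[OF \<open>1 \<le> \<alpha>\<close> *(1,2)] X_dist_ge_1[OF \<open>1 \<le> \<alpha>\<close> *(2,3)] X_dist_ge_1[OF \<open>1 \<le> \<alpha>\<close> *(1,3)] by linarith
  qed
qed

lemma topspace_X_topology: "0 \<le> \<alpha> \<Longrightarrow> topspace (X_topology \<alpha>) = X_space \<alpha>"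
  unfolding X_topology_def by (rule Metric_space.topspace_mtopology[OF Metric_space_X])


section \<open>Convexity on arbitrary subsets of the line\<close>

text \<open>
  The library predicates \<open>convex_on\<close> and \<open>concave_on\<close> require the domain to be a convex set,
  which is not wanted here.
\<close>

definition convex_restr :: "real set \<Rightarrow> (real \<Rightarrow> real) \<Rightarrow> bool" where
  "convex_restr A f \<longleftrightarrow>
     (\<forall>x1\<in>A. \<forall>x2\<in>A. \<forall>x3\<in>A. x1 < x2 \<and> x2 < x3 \<longrightarrow>
        (f x2 - f x1) / (x2 - x1) \<le> (f x3 - f x2) / (x3 - x2))"

definition concave_restr :: "real set \<Rightarrow> (real \<Rightarrow> real) \<Rightarrow> bool" where
  "concave_restr A f \<longleftrightarrow>
     (\<forall>x1\<in>A. \<forall>x2\<in>A. \<forall>x3\<in>A. x1 < x2 \<and> x2 < x3 \<longrightarrow>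
        (f x2 - f x1) / (x2 - x1) \<ge> (f x3 - f x2) / (x3 - x2))"


section \<open>Hausdorff dimension\<close>

text \<open>
  The term \<open>(diam U)\<^sup>s\<close>, with the usual conventions that the empty set contributes \<open>0\<close> and every
  nonempty set contributes \<open>1\<close> when \<open>s = 0\<close> (whereas \<open>0 powr 0 = 0\<close>).
\<close>

definition diam_pow :: "real \<Rightarrow> 'a::metric_space set \<Rightarrow> ennreal" where
  "diam_pow s U = (if U = {} then 0 else if s = 0 then 1 else ennreal (diameter U powr s))"

text \<open>Boundedness is required because \<open>diameter\<close> is only meaningful on bounded sets.\<close>

definition delta_cover :: "real \<Rightarrow> 'a::metric_space set \<Rightarrow> (nat \<Rightarrow> 'a set) \<Rightarrow> bool" where
  "delta_cover \<delta> A U \<longleftrightarrow> A \<subseteq> (\<Union>i. U i) \<and> (\<forall>i. bounded (U i) \<and> diameter (U i) \<le> \<delta>)"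

definition hausdorff_pre :: "real \<Rightarrow> real \<Rightarrow> 'a::metric_space set \<Rightarrow> ennreal" where
  "hausdorff_pre s \<delta> A = (INF U\<in>{U. delta_cover \<delta> A U}. \<Sum>i. diam_pow s (U i))"

definition hausdorff_measure :: "real \<Rightarrow> 'a::metric_space set \<Rightarrow> ennreal" where
  "hausdorff_measure s A = (SUP \<delta>\<in>{0<..}. hausdorff_pre s \<delta> A)"

definition hausdorff_dim :: "'a::metric_space set \<Rightarrow> ereal" where
  "hausdorff_dim A = Inf {ereal s |s. 0 \<le> s \<and> hausdorff_measure s A = 0}"


section \<open>Lower Minkowski dimension\<close>

definition box_count :: "nat \<Rightarrow> nat \<Rightarrow> real set \<Rightarrow> nat" where
  "box_count k l A =
     card {j::int. A \<inter> {(of_int j - 1) / real k ^ l .. of_int j / real k ^ l} \<noteq> {}}"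

text \<open>
  Meant for bounded \<open>A\<close>, for which the set counted above is finite.  Since \<open>ln 0 = 0\<close>, the
  dimension of the empty set is \<open>0\<close>, as for \<open>hausdorff_dim\<close>.
\<close>

definition lower_minkowski_dim :: "nat \<Rightarrow> real set \<Rightarrow> ereal" where
  "lower_minkowski_dim k A =
     liminf (\<lambda>l. ereal (ln (real (box_count k l A)) / (real l * ln (real k))))"

end

theory Submission
  imports Defs
begin

text \<open>Put \<open>b = max 0 (\<alpha> - 1)\<close>. The obstruction to convexity of \<open>f\<close> on a large set is strict concavity
  of a nearby function. If \<open>g'\<close> decreases at rate at least \<open>1\<close> on an interval \<open>J\<close> and \<open>f\<close> is closer to
  \<open>g\<close> than about \<open>r\<^sup>2 / 4\<close>, then \<open>f\<close> cannot be convex on three points of \<open>J\<close> with gaps at least \<open>r\<close>, so the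
  part of \<open>A\<close> in \<open>J\<close> is covered by two intervals of length \<open>r\<close> (\<open>near_concave_cover\<close>). It therefore
  suffices that the functions \<open>g\<close> which are strictly concave outside the union of \<open>N\<close> intervals of length
  \<open>r\<close>, with at most \<open>N\<close> intervals of concavity and \<open>3 * N \<le> r powr - (b + t)\<close>, are dense for every
  \<open>t > 0\<close> with \<open>r\<close> arbitrarily small: being close to such a \<open>g\<close> is an open condition, the space is complete
  (\<open>mcomplete_X_space\<close>), and Baire's theorem lets \<open>t\<close> run through a null sequence. Concavity of \<open>f\<close> is
  convexity of \<open>- f\<close>, so everything is done for \<open>s * f\<close> with a sign \<open>s\<close>. One good scale \<open>r\<close> below every bound
  is all that a lower limit of box counts needs (\<open>lower_minkowski_dim_le_of_covers\<close>).

  To find such a \<open>g\<close> near a given function, first replace the latter by \<open>h\<close> whose derivative is Lipschitz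
  with constant \<open>L\<close> and which satisfies the Hoelder condition with a constant \<open>c < 1\<close>. Averaging preserves
  Hoelder constants (\<open>steklov_approximation\<close>), and a preliminary shrinking produces \<open>c < 1\<close>. Then add a
  primitive of a sawtooth \<open>q\<close> of period \<open>1 / N\<close> that falls with slope \<open>- (L + 1)\<close>, which makes the sum
  strictly concave, and rises within length \<open>r\<close>. The amplitude of \<open>q\<close> is at most \<open>(L + 1) / N\<close> and its
  Lipschitz constant is \<open>(L + 1) / (N * r)\<close>, so its Hoelder constant of exponent \<open>b\<close> is at most
  \<open>(L + 1) / (N * r powr b)\<close> (\<open>sawtooth_holder\<close>). This must not exceed \<open>1 - c\<close>, hence \<open>N\<close> has the order of
  \<open>r powr - b\<close>: that is the source of the exponent \<open>\<alpha> - 1\<close>. For \<open>\<alpha> \<le> 1\<close> the number \<open>N\<close> stays bounded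
  while \<open>r\<close> tends to \<open>0\<close>, which gives dimension \<open>0\<close>.\<close>

section \<open>Box counting\<close>

definition meeting_boxes :: "nat \<Rightarrow> nat \<Rightarrow> real set \<Rightarrow> int set" where
  "meeting_boxes k l A = {j. A \<inter> {(of_int j - 1) / real k ^ l .. of_int j / real k ^ l} \<noteq> {}}"

lemma box_count_eq: "box_count k l A = card (meeting_boxes k l A)"
  by (simp add: box_count_def meeting_boxes_def)

lemma finite_meeting_boxes:
  assumes "A \<subseteq> {0..1}" "k \<ge> 2"
  shows "finite (meeting_boxes k l A)"
proof (rule finite_subset)
  have K: "real k ^ l > 0" using assms by simp
  show "meeting_boxes k l A \<subseteq> {0..int k ^ l + 1}"
  proof
    fix j assume "j \<in> meeting_boxes k l A"
    then obtain x where x: "x \<in> A" "(of_int j - 1) / real k ^ l \<le> x" "x \<le> of_int j / real k ^ l"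
      by (auto simp: meeting_boxes_def)
    then have "0 \<le> x" "x \<le> 1" using assms by auto
    then have "0 \<le> of_int j / real k ^ l" "(of_int j - 1) / real k ^ l \<le> 1" using x by linarith+
    then have 1: "0 \<le> (of_int j :: real)" and 2: "of_int j \<le> real k ^ l + 1"
      using K by (simp_all add: field_simps zero_le_mult_iff)
    from 2 have "(of_int j :: real) \<le> of_int (int k ^ l + 1)" by simp
    then have "j \<le> int k ^ l + 1" by (subst (asm) of_int_le_iff)
    with 1 show "j \<in> {0..int k ^ l + 1}" by simp
  qed
qed simp

lemma mem_meeting_box:
  assumes "x \<in> A" "k \<ge> 2"
  shows "\<exists>j\<in>meeting_boxes k l A. x \<in> {(of_int j - 1) / real k ^ l .. of_int j / real k ^ l}"
proof -
  have K: "real k ^ l > 0" using assms by simp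
  have "x \<in> {(of_int \<lceil>x * real k ^ l\<rceil> - 1) / real k ^ l .. of_int \<lceil>x * real k ^ l\<rceil> / real k ^ l}"
    using K by (simp add: field_simps) linarith
  then show ?thesis using assms unfolding meeting_boxes_def by blast
qed

text \<open>An interval no longer than the mesh meets at most three of the closed boxes.\<close>

lemma box_count_le_cover:
  assumes T: "finite T" "A \<subseteq> (\<Union>t\<in>T. {t..t + r})" and "k \<ge> 2" and r: "r \<le> 1 / real k ^ l"
  shows "box_count k l A \<le> 3 * card T"
proof -
  have K: "real k ^ l > 0" using assms by simp
  have "meeting_boxes k l A \<subseteq> (\<Union>t\<in>T. {\<lceil>t * real k ^ l\<rceil> .. \<lceil>t * real k ^ l\<rceil> + 2})"
  proof
    fix j assume "j \<in> meeting_boxes k l A"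
    then obtain x where x: "x \<in> A" "(of_int j - 1) / real k ^ l \<le> x" "x \<le> of_int j / real k ^ l"
      by (auto simp: meeting_boxes_def)
    with T obtain t where t: "t \<in> T" "t \<le> x" "x \<le> t + r" by auto
    have "t * real k ^ l \<le> of_int j" "of_int j - 1 \<le> (t + 1 / real k ^ l) * real k ^ l"
      using x t r K by (simp_all add: pos_le_divide_eq[symmetric] pos_divide_le_eq[symmetric])
    moreover have "(t + 1 / real k ^ l) * real k ^ l = t * real k ^ l + 1"
      using assms(3) by (simp add: field_simps)
    ultimately have "j \<in> {\<lceil>t * real k ^ l\<rceil> .. \<lceil>t * real k ^ l\<rceil> + 2}" by simp linarith
    then show "j \<in> (\<Union>t\<in>T. {\<lceil>t * real k ^ l\<rceil> .. \<lceil>t * real k ^ l\<rceil> + 2})" using t by blast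
  qed
  then have "box_count k l A \<le> card (\<Union>t\<in>T. {\<lceil>t * real k ^ l\<rceil> .. \<lceil>t * real k ^ l\<rceil> + 2})"
    unfolding box_count_eq using T by (intro card_mono) auto
  also have "\<dots> \<le> (\<Sum>t\<in>T. card {\<lceil>t * real k ^ l\<rceil> .. \<lceil>t * real k ^ l\<rceil> + 2})"
    using T by (intro card_UN_le)
  also have "\<dots> = 3 * card T" by simp
  finally show ?thesis .
qed

section \<open>Comparing the dimensions\<close>

lemma liminf_le_of_frequently:
  fixes X :: "nat \<Rightarrow> ereal"
  assumes "\<exists>\<^sub>F l in sequentially. X l \<le> c"
  shows "liminf X \<le> c"
proof (rule ccontr)
  assume "\<not> liminf X \<le> c"
  then have "eventually (\<lambda>l. c < X l) sequentially" by (intro less_LiminfD) simp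
  then have "eventually (\<lambda>l. \<not> X l \<le> c) sequentially" by eventually_elim simp
  then show False using assms by (simp add: frequently_def)
qed

lemma lower_minkowski_dim_nonneg: "k \<ge> 2 \<Longrightarrow> 0 \<le> lower_minkowski_dim k A"
  unfolding lower_minkowski_dim_def
proof (intro Liminf_bounded always_eventually allI)
  fix l assume "k \<ge> 2"
  then show "0 \<le> ereal (ln (real (box_count k l A)) / (real l * ln (real k)))"
    by (cases "box_count k l A = 0") (auto intro!: divide_nonneg_nonneg mult_nonneg_nonneg)
qed

lemma hausdorff_pre_le_boxes:
  assumes A: "A \<subseteq> {0..1}" and "k \<ge> 2" "s > 0" "1 / real k ^ l \<le> \<delta>"
  shows "hausdorff_pre s \<delta> A \<le> ennreal (real (box_count k l A) * (1 / real k ^ l) powr s)"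
proof -
  define J where "J = meeting_boxes k l A"
  define w where "w = 1 / real k ^ l"
  have w: "w > 0" using assms by (simp add: w_def)
  have fJ: "finite J" unfolding J_def by (rule finite_meeting_boxes) fact+
  then obtain h where h: "bij_betw h {0..<card J} J" using ex_bij_betw_nat_finite by blast
  \<comment> \<open>The sequence is padded with empty sets, which contribute \<open>0\<close> to the sum.\<close>
  define U where "U i = (if i < card J then {(of_int (h i) - 1) / real k ^ l .. of_int (h i) / real k ^ l} else {})" for i
  have diam: "diameter (U i) = (if i < card J then w else 0)" for i
    using assms(2) by (auto simp: U_def w_def diff_divide_distrib not_less)
  have ne: "U i \<noteq> {}" if "i < card J" for i
    using that assms(2) by (auto simp: U_def diff_divide_distrib)
  have "delta_cover \<delta> A U"
    unfolding delta_cover_def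
  proof (intro conjI allI)
    show "A \<subseteq> (\<Union>i. U i)"
    proof
      fix x assume "x \<in> A"
      from mem_meeting_box[OF this assms(2), of l] obtain j where
        j: "j \<in> J" "x \<in> {(of_int j - 1) / real k ^ l .. of_int j / real k ^ l}"
        unfolding J_def by blast
      then obtain i where "i < card J" "h i = j" using h unfolding bij_betw_def by (metis atLeastLessThan_iff imageE)
      then show "x \<in> (\<Union>i. U i)" using j by (auto simp: U_def)
    qed
    show "bounded (U i)" for i by (simp add: U_def)
    show "diameter (U i) \<le> \<delta>" for i using diam[of i] w assms(4)[folded w_def] by auto
  qed
  then have "hausdorff_pre s \<delta> A \<le> (\<Sum>i. diam_pow s (U i))"
    unfolding hausdorff_pre_def by (intro INF_lower) simp
  also have "\<dots> = (\<Sum>i<card J. diam_pow s (U i))"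
    by (rule suminf_finite) (auto simp: diam_pow_def U_def)
  also have "\<dots> = (\<Sum>i<card J. ennreal (w powr s))"
    using ne assms(3) by (intro sum.cong refl) (simp add: diam_pow_def diam)
  also have "\<dots> = ennreal (real (box_count k l A) * w powr s)"
    by (simp add: box_count_eq J_def ennreal_mult ennreal_of_nat_eq_real_of_nat)
  finally show ?thesis by (simp add: w_def)
qed

lemma box_count_le_of_exponent:
  assumes "k \<ge> 2" "l > 0" "ln (real (box_count k l A)) / (real l * ln (real k)) \<le> t"
  shows "real (box_count k l A) \<le> (real k ^ l) powr t"
proof (cases "box_count k l A = 0")
  case False
  have k: "ln (real k) > 0" using assms by simp
  have "ln (real (box_count k l A)) \<le> t * (real l * ln (real k))"
    using assms k by (simp add: divide_simps)
  also have "\<dots> = ln ((real k ^ l) powr t)"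
    using assms by (simp add: ln_powr ln_realpow)
  finally show ?thesis using False assms by (subst (asm) ln_le_cancel_iff) auto
qed simp

text \<open>For \<open>lower_minkowski_dim k A < t < s\<close>, infinitely many \<open>l\<close> have at most \<open>(k ^ l) powr t\<close> boxes, and
  covering by these boxes makes the \<open>s\<close>-dimensional sum at most \<open>(1 / k ^ l) powr (s - t)\<close>, which tends
  to \<open>0\<close>.\<close>

lemma hausdorff_dim_le_lower_minkowski_dim:
  assumes A: "A \<subseteq> {0..1}" and k: "k \<ge> 2"
  shows "hausdorff_dim A \<le> lower_minkowski_dim k A"
proof (rule ccontr)
  assume "\<not> ?thesis"
  then obtain s where s: "lower_minkowski_dim k A < ereal s" "ereal s < hausdorff_dim A"
    by (metis ereal_dense2 not_le)
  then obtain t where t: "lower_minkowski_dim k A < ereal t" "ereal t < ereal s"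
    using ereal_dense2 by blast
  have "0 < ereal t" using lower_minkowski_dim_nonneg[OF k, of A] t(1) by (rule order_le_less_trans)
  with t have t0: "0 < t" "t < s" by simp_all
  have fr: "\<exists>\<^sub>F l in sequentially. ln (real (box_count k l A)) / (real l * ln (real k)) \<le> t"
  proof (rule ccontr)
    assume "\<not> ?thesis"
    then have "eventually (\<lambda>l. ereal t \<le> ereal (ln (real (box_count k l A)) / (real l * ln (real k)))) sequentially"
      by (auto simp: frequently_def elim!: eventually_mono)
    from Liminf_bounded[OF this] t(1) show False
      unfolding lower_minkowski_dim_def by simp
  qed
  have "hausdorff_pre s \<delta> A \<le> 0" if d: "\<delta> > 0" for \<delta>
  proof (rule ennreal_le_epsilon)
    fix e :: real assume e: "0 < e"
    have lim: "(\<lambda>l. (1 / real k) ^ l) \<longlonglongrightarrow> 0"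
      using k by (intro LIMSEQ_power_zero) simp
    have "((\<lambda>l. ((1 / real k) ^ l) powr (s - t)) \<longlongrightarrow> 0) sequentially"
      by (rule tendsto_zero_powrI[OF lim tendsto_const]) (use t0 in auto)
    then have "eventually (\<lambda>l. ((1 / real k) ^ l) powr (s - t) < e) sequentially"
      by (rule order_tendstoD) fact
    moreover have "eventually (\<lambda>l. (1 / real k) ^ l < \<delta>) sequentially"
      by (rule order_tendstoD(2)[OF lim d])
    ultimately have "eventually (\<lambda>l. l > 0 \<and> ((1 / real k) ^ l) powr (s - t) < e \<and> (1 / real k) ^ l < \<delta>) sequentially"
      using eventually_gt_at_top[of 0] by eventually_elim simp
    from frequently_ex[OF frequently_eventually_conj[OF fr this]] obtain l
      where l: "ln (real (box_count k l A)) / (real l * ln (real k)) \<le> t" "l > 0"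
        "((1 / real k) ^ l) powr (s - t) < e" "(1 / real k) ^ l < \<delta>" by blast
    have "hausdorff_pre s \<delta> A \<le> ennreal (real (box_count k l A) * (1 / real k ^ l) powr s)"
      using t0 l by (intro hausdorff_pre_le_boxes assms) (auto simp: power_one_over)
    also have "\<dots> \<le> ennreal ((real k ^ l) powr t * (1 / real k ^ l) powr s)"
      by (intro ennreal_leI mult_right_mono box_count_le_of_exponent k l) simp
    also have "(real k ^ l) powr t * (1 / real k ^ l) powr s = ((1 / real k) ^ l) powr (s - t)"
      using k by (simp add: power_one_over powr_diff powr_divide)
    also have "ennreal \<dots> \<le> 0 + ennreal e" using l by (simp add: ennreal_leI)
    finally show "hausdorff_pre s \<delta> A \<le> 0 + ennreal e" .
  qed
  then have "hausdorff_measure s A = 0"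
    unfolding hausdorff_measure_def by (auto intro!: antisym SUP_least)
  then have "hausdorff_dim A \<le> ereal s"
    unfolding hausdorff_dim_def using t0 by (intro Inf_lower) auto
  then show False using s by simp
qed

text \<open>One admissible scale \<open>r\<close> controls the box count at the mesh \<open>k\<^sup>-\<^sup>l\<close> with
  \<open>k\<^sup>-\<^sup>l\<^sup>-\<^sup>1 < r \<le> k\<^sup>-\<^sup>l\<close>; the loss is a constant factor, which the division by \<open>l\<close> absorbs.\<close>

lemma lower_minkowski_dim_le_of_covers:
  assumes k: "k \<ge> 2" and b: "b \<ge> 0"
    and cov: "\<And>t. t > 0 \<Longrightarrow> \<exists>r T. 0 < r \<and> r < t \<and> finite T \<and> real (card T) \<le> r powr (- (b + t)) \<and>
              A \<subseteq> (\<Union>x\<in>T. {x..x + r})"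
  shows "lower_minkowski_dim k A \<le> ereal b"
proof (rule ereal_le_epsilon2)
  fix e :: real assume e: "0 < e"
  define c where "c = b + e / 2"
  have k1: "real k > 1" "ln (real k) > 0" using k by auto
  have "(\<lambda>l. ln 3 / ln (real k) * (1 / real l) + (1 + 1 / real l) * c) \<longlonglongrightarrow> ln 3 / ln (real k) * 0 + (1 + 0) * c"
    by (intro tendsto_intros lim_1_over_n)
  then have ev: "eventually (\<lambda>l. ln 3 / ln (real k) * (1 / real l) + (1 + 1 / real l) * c < b + e) sequentially"
    by (rule order_tendstoD) (use e in \<open>simp add: c_def\<close>)
  have "\<exists>\<^sub>F l in sequentially. ereal (ln (real (box_count k l A)) / (real l * ln (real k))) \<le> ereal (b + e)"
    unfolding frequently_def eventually_sequentially not_ex not_all not_imp not_not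
  proof
    fix l0
    obtain L where L: "L \<ge> l0" "L > 0"
      "\<And>l. l \<ge> L \<Longrightarrow> ln 3 / ln (real k) * (1 / real l) + (1 + 1 / real l) * c < b + e"
      using ev unfolding eventually_sequentially
      by (metis le_add1 le_add2 add_gr_0 zero_less_one le_trans add.commute)
    \<comment> \<open>The second bound on \<open>t\<close> forces the mesh exponent \<open>l\<close> that matches \<open>r\<close> to be at least \<open>L\<close>.\<close>
    define t where "t = min (e / 2) (1 / real k ^ L)"
    have "t > 0" using e k by (simp add: t_def)
    from cov[OF this] obtain r T where r: "0 < r" "r < t" "finite T"
      "real (card T) \<le> r powr (- (b + t))" "A \<subseteq> (\<Union>x\<in>T. {x..x + r})" by blast
    have rL: "r < 1 / real k ^ L" using r by (simp add: t_def)
    have r1: "r < 1" using rL k1 by (smt (verit) divide_le_eq_1 one_le_power)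
    define l where "l = nat \<lfloor>log (real k) (1 / r)\<rfloor>"
    have lg: "log (real k) (1 / r) > real L"
      using rL r k1 by (subst less_log_iff) (auto simp: powr_realpow field_simps)
    have l1: "real l \<le> log (real k) (1 / r)" "log (real k) (1 / r) < real l + 1"
      using lg unfolding l_def by linarith+
    have lL: "l \<ge> L" using lg unfolding l_def by linarith
    have a: "real k ^ l \<le> 1 / r"
      using l1(1) r k1 by (subst (asm) le_log_iff) (auto simp: powr_realpow)
    have bb: "1 / r < real k ^ (l + 1)"
      using l1(2) r k1 by (subst (asm) log_less_iff) (auto simp: powr_realpow powr_add mult.commute)
    have "real (box_count k l A) \<le> real (3 * card T)"
      using box_count_le_cover[OF r(3,5) k, of l] a k1 r(1) by (simp add: field_simps)
    also have "\<dots> \<le> 3 * r powr (- (b + t))" using r by simp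
    also have "\<dots> = 3 * (1 / r) powr (b + t)"
      using r by (subst powr_minus_divide) (simp add: powr_divide)
    also have "\<dots> \<le> 3 * (1 / r) powr c" using r r1
      by (intro mult_left_mono powr_mono) (auto simp: c_def t_def)
    also have "\<dots> \<le> 3 * (real k ^ (l + 1)) powr c"
      using bb r b e by (intro mult_left_mono powr_mono2) (auto simp: c_def)
    finally have bc: "real (box_count k l A) \<le> 3 * (real k ^ (l + 1)) powr c" .
    have l0: "real l > 0" using lL L by simp
    have "ln (real (box_count k l A)) \<le> ln (3 * (real k ^ (l + 1)) powr c)"
    proof (cases "box_count k l A = 0")
      case True
      have "1 \<le> (real k ^ (l + 1)) powr c" using k1 b e
        by (intro ge_one_powr_ge_zero one_le_power) (auto simp: c_def)
      then show ?thesis using True by simp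
    next
      case False
      then show ?thesis using bc k1 by (subst ln_le_cancel_iff) auto
    qed
    also have "\<dots> = ln 3 + c * ((real l + 1) * ln (real k))"
      using k1 by (simp add: ln_mult ln_powr ln_realpow algebra_simps)
    finally have "ln (real (box_count k l A)) / (real l * ln (real k))
        \<le> (ln 3 + c * ((real l + 1) * ln (real k))) / (real l * ln (real k))"
      using k1 l0 by (intro divide_right_mono) auto
    also have "\<dots> = ln 3 / ln (real k) * (1 / real l) + (1 + 1 / real l) * c"
      using k1 l0 by (simp add: divide_simps)
    also have "\<dots> < b + e" using L(3)[OF lL] .
    finally show "\<exists>l. l \<ge> l0 \<and> ereal (ln (real (box_count k l A)) / (real l * ln (real k))) \<le> ereal (b + e)"
      using lL L(1) by (intro exI[of _ l]) auto
  qed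
  from liminf_le_of_frequently[OF this] show "lower_minkowski_dim k A \<le> ereal b + ereal e"
    by (simp add: lower_minkowski_dim_def)
qed

section \<open>The spaces as complete metric spaces\<close>

text \<open>The exponent \<open>0\<close> stands for mere continuity. With this convention a single predicate, applied to the
  function for \<open>\<alpha> < 1\<close> and to its derivative for \<open>\<alpha> \<ge> 1\<close>, describes all the spaces, including \<open>C[0,1]\<close>
  and \<open>C\<^sup>1[0,1]\<close>.\<close>

definition holder_ball :: "real \<Rightarrow> real \<Rightarrow> (real \<Rightarrow> real) \<Rightarrow> bool" where
  "holder_ball b c u \<longleftrightarrow> continuous_on {0..1} u \<and>
     (b \<noteq> 0 \<longrightarrow> (\<forall>x\<in>{0..1}. \<forall>y\<in>{0..1}. \<bar>u x - u y\<bar> \<le> c * \<bar>x - y\<bar> powr b))"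

lemma holder_ball_cong: "(\<And>x. x \<in> {0..1} \<Longrightarrow> u x = v x) \<Longrightarrow> holder_ball b c u \<longleftrightarrow> holder_ball b c v"
  using continuous_on_cong[OF refl, of "{0..1}" u v] unfolding holder_ball_def by simp

lemma holder_ball_add_scaled:
  assumes "holder_ball b c u" "holder_ball b d v"
  shows "holder_ball b (\<bar>s\<bar> * c + \<bar>t\<bar> * d) (\<lambda>x. s * u x + t * v x)"
  unfolding holder_ball_def
proof (intro conjI impI ballI)
  show "continuous_on {0..1} (\<lambda>x. s * u x + t * v x)"
    using assms by (auto simp: holder_ball_def intro!: continuous_intros)
  fix x y :: real assume b: "b \<noteq> 0" and xy: "x \<in> {0..1}" "y \<in> {0..1}"
  have "\<bar>(s * u x + t * v x) - (s * u y + t * v y)\<bar> \<le> \<bar>s * (u x - u y)\<bar> + \<bar>t * (v x - v y)\<bar>"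
    by (simp add: algebra_simps)
  also have "\<dots> \<le> \<bar>s\<bar> * (c * \<bar>x - y\<bar> powr b) + \<bar>t\<bar> * (d * \<bar>x - y\<bar> powr b)"
    unfolding abs_mult using assms b xy
    by (intro add_mono mult_left_mono) (auto simp: holder_ball_def)
  finally show "\<bar>(s * u x + t * v x) - (s * u y + t * v y)\<bar> \<le> (\<bar>s\<bar> * c + \<bar>t\<bar> * d) * \<bar>x - y\<bar> powr b"
    by (simp add: algebra_simps)
qed

lemma holder_ball_mono:
  assumes "holder_ball b c u" "c \<le> d" shows "holder_ball b d u"
proof -
  have "c * \<bar>x - y\<bar> powr b \<le> d * \<bar>x - y\<bar> powr b" for x y :: real
    using assms(2) by (rule mult_right_mono) simp
  then show ?thesis using assms(1) unfolding holder_ball_def by (meson order_trans)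
qed

lemma holder_ball_uniform_limit:
  assumes "\<And>n. holder_ball b c (u n)" "uniform_limit {0..1} u v sequentially"
  shows "holder_ball b c v"
  unfolding holder_ball_def
proof (intro conjI impI ballI)
  show "continuous_on {0..1} v"
    using assms by (intro uniform_limit_theorem[OF _ assms(2)]) (auto simp: holder_ball_def)
  fix x y :: real assume b: "b \<noteq> 0" and xy: "x \<in> {0..1}" "y \<in> {0..1}"
  have "(\<lambda>n. \<bar>u n x - u n y\<bar>) \<longlonglongrightarrow> \<bar>v x - v y\<bar>"
    using xy by (intro tendsto_intros tendsto_uniform_limitI[OF assms(2)])
  then show "\<bar>v x - v y\<bar> \<le> c * \<bar>x - y\<bar> powr b"
    by (rule LIMSEQ_le_const2) (use assms(1) b xy in \<open>auto simp: holder_ball_def\<close>)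
qed

lemma X_space_less_1:
  assumes "0 \<le> \<alpha>" "\<alpha> < 1"
  shows "f \<in> X_space \<alpha> \<longleftrightarrow> f \<in> extensional {0..1} \<and> holder_ball \<alpha> 1 f"
  using assms X_space_continuous[OF assms(1), of f]
  by (auto simp: X_space_def C_space_def Holder_space_def holder_ball_def)

lemma X_space_ge_1:
  assumes "1 \<le> \<alpha>"
  shows "f \<in> X_space \<alpha> \<longleftrightarrow>
    f \<in> extensional {0..1} \<and> f differentiable_on {0..1} \<and> holder_ball (\<alpha> - 1) 1 (deriv01 f)"
  using assms X_space_deriv_continuous[OF _ assms, of f]
  by (auto simp: X_space_def C1_space_def Holder_space_def holder_ball_def)

lemma X_dist_bounds:
  assumes "0 \<le> \<alpha>" "f \<in> X_space \<alpha>" "g \<in> X_space \<alpha>" "x \<in> {0..1}"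
  shows "\<bar>f x - g x\<bar> \<le> X_dist \<alpha> f g"
    and "1 \<le> \<alpha> \<Longrightarrow> \<bar>deriv01 f x - deriv01 g x\<bar> \<le> X_dist \<alpha> f g"
proof -
  have "\<bar>f x - g x\<bar> \<le> norm0 (\<lambda>x. f x - g x)"
    using assms by (intro norm0_upper continuous_on_diff X_space_continuous)
  then show "\<bar>f x - g x\<bar> \<le> X_dist \<alpha> f g"
    using assms by (cases "\<alpha> < 1") (auto simp: X_dist_less_1 X_dist_ge_1)
  assume "1 \<le> \<alpha>"
  then have "\<bar>deriv01 f x - deriv01 g x\<bar> \<le> norm0 (\<lambda>x. deriv01 f x - deriv01 g x)"
    using assms by (intro norm0_upper[where h = "\<lambda>x. deriv01 f x - deriv01 g x"] continuous_on_diff X_space_deriv_continuous)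
  then show "\<bar>deriv01 f x - deriv01 g x\<bar> \<le> X_dist \<alpha> f g"
    using assms \<open>1 \<le> \<alpha>\<close> by (auto simp: X_dist_ge_1)
qed

lemma X_dist_le:
  assumes "f \<in> X_space \<alpha>" "g \<in> X_space \<alpha>"
    and "\<And>x. x \<in> {0..1} \<Longrightarrow> \<bar>f x - g x\<bar> \<le> e"
    and "\<And>x. 1 \<le> \<alpha> \<Longrightarrow> x \<in> {0..1} \<Longrightarrow> \<bar>deriv01 f x - deriv01 g x\<bar> \<le> e"
  shows "X_dist \<alpha> f g \<le> e"
  using assms by (cases "\<alpha> < 1") (auto simp: X_dist_less_1 X_dist_ge_1 intro!: norm0_least)

text \<open>Cauchy sequences converge uniformly, together with their derivatives when \<open>\<alpha> \<ge> 1\<close>; the limit of the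
  derivatives is then the derivative of the limit, and Hoelder conditions pass to uniform limits.\<close>

lemma mcomplete_X_space:
  assumes a: "0 \<le> \<alpha>"
  shows "Metric_space.mcomplete (X_space \<alpha>) (X_dist \<alpha>)"
proof -
  interpret M: Metric_space "X_space \<alpha>" "X_dist \<alpha>" by (rule Metric_space_X[OF a])
  have "\<exists>g. limitin M.mtopology F g sequentially" if "M.MCauchy F" for F
  proof -
    have F: "F n \<in> X_space \<alpha>" for n using that by (auto simp: M.MCauchy_def)
    have Cau: "\<exists>N. \<forall>n n'. N \<le> n \<longrightarrow> N \<le> n' \<longrightarrow> X_dist \<alpha> (F n) (F n') < e" if "e > 0" for e
      using \<open>M.MCauchy F\<close> that by (auto simp: M.MCauchy_def)
    have uc: "uniformly_convergent_on {0..1} F"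
      unfolding uniformly_convergent_eq_Cauchy uniformly_Cauchy_on_def dist_real_def
      using Cau X_dist_bounds(1)[OF a F F] order_le_less_trans by meson
    then obtain l where l: "uniform_limit {0..1} F l sequentially"
      by (auto simp: uniformly_convergent_on_def)
    define g where "g = restrict l {0..1}"
    have ul: "uniform_limit {0..1} F g sequentially"
      using l by (rule uniform_limit_cong'[THEN iffD1, rotated 2]) (auto simp: g_def)
    have *: "g \<in> X_space \<alpha> \<and> (1 \<le> \<alpha> \<longrightarrow> uniform_limit {0..1} (\<lambda>n. deriv01 (F n)) (deriv01 g) sequentially)"
    proof (cases "\<alpha> < 1")
      case True
      have "holder_ball \<alpha> 1 g"
        using F True a by (intro holder_ball_uniform_limit[OF _ ul]) (auto simp: X_space_less_1)
      then show ?thesis using True a by (simp add: X_space_less_1 g_def)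
    next
      case False
      then have a1: "1 \<le> \<alpha>" by simp
      have "uniformly_convergent_on {0..1} (\<lambda>n. deriv01 (F n))"
        unfolding uniformly_convergent_eq_Cauchy uniformly_Cauchy_on_def dist_real_def
        using Cau X_dist_bounds(2)[OF a F F _ a1] order_le_less_trans by meson
      then obtain D where D: "uniform_limit {0..1} (\<lambda>n. deriv01 (F n)) D sequentially"
        by (auto simp: uniformly_convergent_on_def)
      have "\<exists>G. \<forall>x\<in>{0..1}. (\<lambda>n. F n x) \<longlonglongrightarrow> G x \<and>
            (G has_derivative (\<lambda>h. h * D x)) (at x within {0..1})"
      proof (rule has_derivative_sequence[where f' = "\<lambda>n x h. h * deriv01 (F n) x"])
        show "(F n has_derivative (\<lambda>h. h * deriv01 (F n) x)) (at x within {0..1})"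
          if "x \<in> {0..1}" for n x
          using has_vector_derivative_deriv01[OF X_space_differentiable[OF F a1] that]
          by (simp add: has_vector_derivative_def)
        show "\<forall>\<^sub>F n in sequentially. \<forall>x\<in>{0..1}. \<forall>h. norm (h * deriv01 (F n) x - h * D x) \<le> e * norm h"
          if "e > 0" for e
          using uniform_limitD[OF D that]
        proof eventually_elim
          case (elim n)
          show ?case
          proof (intro ballI allI)
            fix x h :: real assume "x \<in> {0..1}"
            then have "\<bar>deriv01 (F n) x - D x\<bar> \<le> e" using elim by (force simp: dist_real_def)
            then have "\<bar>h\<bar> * \<bar>deriv01 (F n) x - D x\<bar> \<le> \<bar>h\<bar> * e" by (rule mult_left_mono) simp
            then show "norm (h * deriv01 (F n) x - h * D x) \<le> e * norm h"
              by (simp add: abs_mult[symmetric] right_diff_distrib mult.commute)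
          qed
        qed
        show "(\<lambda>n. F n 0) \<longlonglongrightarrow> g 0" by (rule tendsto_uniform_limitI[OF ul]) simp
      qed simp_all
      then obtain G where G: "\<And>x. x \<in> {0..1} \<Longrightarrow> (\<lambda>n. F n x) \<longlonglongrightarrow> G x"
        "\<And>x. x \<in> {0..1} \<Longrightarrow> (G has_vector_derivative D x) (at x within {0..1})"
        unfolding has_vector_derivative_def real_scaleR_def by blast
      have "G x = g x" if "x \<in> {0..1}" for x
        using LIMSEQ_unique[OF G(1)[OF that] tendsto_uniform_limitI[OF ul that]] .
      then have vd: "(g has_vector_derivative D x) (at x within {0..1})" if "x \<in> {0..1}" for x
        using G(2)[OF that] that by (auto elim: has_vector_derivative_transform[rotated 2])
      then have Dg: "deriv01 g x = D x" if "x \<in> {0..1}" for x using that by (intro deriv01_eqI)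
      have u: "uniform_limit {0..1} (\<lambda>n. deriv01 (F n)) (deriv01 g) sequentially"
        using D by (rule uniform_limit_cong'[THEN iffD1, rotated 2]) (auto simp: Dg)
      have "g differentiable_on {0..1}"
        unfolding differentiable_on_def using vd differentiableI_vector by blast
      moreover have "holder_ball (\<alpha> - 1) 1 (deriv01 g)"
        using F a1 by (intro holder_ball_uniform_limit[OF _ u]) (auto simp: X_space_ge_1)
      ultimately show ?thesis using u a1 by (simp add: X_space_ge_1 g_def)
    qed
    have "limitin M.mtopology F g sequentially"
      unfolding M.limit_metric_sequentially
    proof (intro conjI allI impI)
      show "g \<in> X_space \<alpha>" using * by simp
      fix e :: real assume "e > 0"
      then have e2: "e / 2 > 0" by simp
      have "eventually (\<lambda>n. X_dist \<alpha> (F n) g \<le> e / 2) sequentially"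
      proof (cases "1 \<le> \<alpha>")
        case True
        with * have "uniform_limit {0..1} (\<lambda>n. deriv01 (F n)) (deriv01 g) sequentially" by simp
        from uniform_limitD[OF ul e2] uniform_limitD[OF this e2] show ?thesis
          by eventually_elim (intro X_dist_le F, insert *, auto simp: dist_real_def intro: less_imp_le)
      next
        case False
        from uniform_limitD[OF ul e2] show ?thesis
          by eventually_elim (intro X_dist_le F, insert * False, auto simp: dist_real_def intro: less_imp_le)
      qed
      then have "eventually (\<lambda>n. F n \<in> X_space \<alpha> \<and> X_dist \<alpha> (F n) g < e) sequentially"
        using F \<open>e > 0\<close> by (auto elim!: eventually_mono)
      then show "\<exists>N. \<forall>n\<ge>N. F n \<in> X_space \<alpha> \<and> X_dist \<alpha> (F n) g < e"
        by (simp add: eventually_sequentially)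
    qed
    then show ?thesis by blast
  qed
  then show ?thesis by (auto simp: M.mcomplete_def)
qed

section \<open>Smoothing inside a Hoelder ball\<close>

lemma antiderivative01:
  fixes u :: "real \<Rightarrow> real"
  assumes "continuous_on {0..1} u"
  obtains F where "F 0 = c" "\<And>x. x \<in> {0..1} \<Longrightarrow> (F has_real_derivative u x) (at x within {0..1})"
proof -
  obtain F where F: "\<And>x. x \<in> {0..1} \<Longrightarrow> (F has_vector_derivative u x) (at x within {0..1})"
    using antiderivative_continuous[OF assms] by blast
  have "((\<lambda>x. F x - F 0 + c) has_real_derivative u x) (at x within {0..1})" if "x \<in> {0..1}" for x
    using F[OF that] unfolding has_real_derivative_iff_has_vector_derivative[symmetric]
    by (auto intro!: derivative_eq_intros)
  then show thesis by (intro that[of "\<lambda>x. F x - F 0 + c"]) auto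
qed

lemma mean_value01:
  assumes "\<And>x. x \<in> {0..1} \<Longrightarrow> (F has_real_derivative u x) (at x within {0..1})"
    and "0 \<le> a" "a \<le> b" "b \<le> 1"
  shows "\<exists>x\<in>{a..b}. F b - F a = u x * (b - a)"
  using assms by (intro mvt_very_simple)
    (auto simp: has_field_derivative_def[symmetric] intro!: DERIV_subset[of F _ _ "{0..1}" "{a..b}"])

lemma lipschitz_of_deriv_bound:
  assumes F: "\<And>x. x \<in> {0..1} \<Longrightarrow> (F has_real_derivative u x) (at x within {0..1})"
    and B: "\<And>x. x \<in> {0..1} \<Longrightarrow> \<bar>u x\<bar> \<le> B" and xy: "x \<in> {0..1}" "y \<in> {0..1}"
  shows "\<bar>F x - F y\<bar> \<le> B * \<bar>x - y\<bar>"
proof -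
  have *: "\<bar>F b - F a\<bar> \<le> B * \<bar>b - a\<bar>" if "a \<in> {0..1}" "b \<in> {0..1}" "a \<le> b" for a b
  proof -
    have "0 \<le> a" "b \<le> 1" using that by auto
    then obtain t where "t \<in> {a..b}" "F b - F a = u t * (b - a)"
      using mean_value01[of F u a b, OF F] \<open>a \<le> b\<close> by blast
    then show ?thesis using B[of t] that by (auto simp: abs_mult intro: mult_right_mono)
  qed
  show ?thesis using *[of x y] *[of y x] xy by (cases "x \<le> y") (auto simp: abs_minus_commute)
qed

text \<open>If \<open>F\<close> is a primitive of \<open>u\<close>, this is the mean of \<open>u\<close> over the window from \<open>(1 - d) * x\<close> to
  \<open>(1 - d) * x + d\<close>. The contraction by \<open>1 - d\<close> keeps the window inside the unit interval, so that no
  extension of \<open>u\<close> is needed.\<close>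

definition steklov :: "real \<Rightarrow> (real \<Rightarrow> real) \<Rightarrow> real \<Rightarrow> real" where
  "steklov d F x = (F ((1 - d) * x + d) - F ((1 - d) * x)) / d"

lemma steklov_point:
  assumes "0 < d" "d < 1" "x \<in> {0..1}" "t \<in> {0..d}"
  shows "(1 - d) * x + t \<in> {0..1::real}"
proof -
  have "(1 - d) * x \<le> 1 - d" "0 \<le> (1 - d) * x" using assms by (auto intro!: mult_left_le)
  then show ?thesis using assms(4) unfolding atLeastAtMost_iff by linarith
qed

lemma affine_chain:
  assumes F: "\<And>x. x \<in> {0..1} \<Longrightarrow> (F has_real_derivative u x) (at x within {0..1})"
    and "\<And>x. x \<in> S \<Longrightarrow> m * x + t \<in> {0..1}" "x \<in> S"
  shows "((\<lambda>x. F (m * x + t)) has_real_derivative u (m * x + t) * m) (at x within S)"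
proof -
  have "(F \<circ> (\<lambda>x. m * x + t) has_real_derivative u (m * x + t) * m) (at x within S)"
  proof (rule DERIV_image_chain)
    show "(F has_real_derivative u (m * x + t)) (at (m * x + t) within (\<lambda>x. m * x + t) ` S)"
      by (rule DERIV_subset[OF F]) (use assms in auto)
    show "((\<lambda>x. m * x + t) has_real_derivative m) (at x within S)"
      by (auto intro!: derivative_eq_intros)
  qed
  then show ?thesis by (simp add: o_def)
qed

lemma steklov_has_derivative:
  assumes F: "\<And>x. x \<in> {0..1} \<Longrightarrow> (F has_real_derivative u x) (at x within {0..1})"
    and d: "0 < d" "d < 1" and x: "x \<in> {0..1}"
  shows "(steklov d F has_real_derivative (1 - d) / d * (u ((1 - d) * x + d) - u ((1 - d) * x)))
           (at x within {0..1})"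
proof -
  have "((\<lambda>x. F ((1 - d) * x + t)) has_real_derivative u ((1 - d) * x + t) * (1 - d)) (at x within {0..1})"
    if "t \<in> {0..d}" for t
    using steklov_point[OF d _ that] x by (intro affine_chain[OF F])
  from this[of d] this[of 0] d have
    "((\<lambda>x. F ((1 - d) * x + d)) has_real_derivative u ((1 - d) * x + d) * (1 - d)) (at x within {0..1})"
    "((\<lambda>x. F ((1 - d) * x)) has_real_derivative u ((1 - d) * x) * (1 - d)) (at x within {0..1})"
    by auto
  from DERIV_cdivide[OF DERIV_diff[OF this], of d] show ?thesis
    unfolding steklov_def[abs_def] by (rule DERIV_cong) (use d in \<open>simp add: field_simps\<close>)
qed

text \<open>The mean value theorem turns differences of averages into differences of values of \<open>u\<close>
  at points no further apart, so every modulus of continuity of \<open>u\<close> is inherited.\<close>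

lemma steklov_diff_eq:
  assumes F: "\<And>x. x \<in> {0..1} \<Longrightarrow> (F has_real_derivative u x) (at x within {0..1})"
    and d: "0 < d" "d < 1" and xy: "x \<in> {0..1}" "y \<in> {0..1}"
  obtains t where "t \<in> {0..d}"
    "steklov d F x - steklov d F y = u ((1 - d) * x + t) - u ((1 - d) * y + t)"
proof -
  define G where "G t = F ((1 - d) * x + t) - F ((1 - d) * y + t)" for t
  have G: "(G has_real_derivative u ((1 - d) * x + t) - u ((1 - d) * y + t)) (at t within {0..d})"
    if "t \<in> {0..d}" for t
  proof -
    have "((\<lambda>t. F (1 * t + (1 - d) * z)) has_real_derivative u (1 * t + (1 - d) * z) * 1) (at t within {0..d})"
      if "z \<in> {0..1}" for z
      using steklov_point[OF d that] \<open>t \<in> {0..d}\<close> by (intro affine_chain[OF F]) (auto simp: add.commute)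
    from DERIV_diff[OF this[OF xy(1)] this[OF xy(2)]] show ?thesis
      by (simp add: G_def[abs_def] add.commute)
  qed
  have "\<exists>t\<in>{0..d}. G d - G 0 = (u ((1 - d) * x + t) - u ((1 - d) * y + t)) * (d - 0)"
    using d G by (intro mvt_very_simple) (auto simp: has_field_derivative_def[symmetric])
  then obtain t where "t \<in> {0..d}" "G d - G 0 = (u ((1 - d) * x + t) - u ((1 - d) * y + t)) * d"
    by auto
  moreover have "steklov d F x - steklov d F y = (G d - G 0) / d"
    by (simp add: G_def steklov_def diff_divide_distrib)
  ultimately show thesis using d by (intro that[of t]) auto
qed

lemma steklov_eq:
  assumes F: "\<And>x. x \<in> {0..1} \<Longrightarrow> (F has_real_derivative u x) (at x within {0..1})"
    and d: "0 < d" "d < 1" and x: "x \<in> {0..1}"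
  obtains t where "t \<in> {0..1}" "\<bar>t - x\<bar> \<le> d" "steklov d F x = u t"
proof -
  have "0 \<le> (1 - d) * x" "(1 - d) * x + d \<le> 1"
    using steklov_point[OF d x, of 0] steklov_point[OF d x, of d] d by auto
  from mean_value01[of F u, OF F this(1) _ this(2)] d obtain t where
    t: "t \<in> {(1 - d) * x..(1 - d) * x + d}" "F ((1 - d) * x + d) - F ((1 - d) * x) = u t * d"
    by (auto simp: Bex_def)
  have "0 \<le> d * x" "d * x \<le> d * 1" using d x by (auto intro: mult_left_mono)
  then have "\<bar>t - x\<bar> \<le> d" using t(1) by (auto simp: algebra_simps)
  moreover have "t \<in> {0..1}" using t \<open>0 \<le> (1 - d) * x\<close> \<open>(1 - d) * x + d \<le> 1\<close> by auto
  ultimately show thesis using t(2) d by (intro that[of t]) (auto simp: steklov_def)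
qed

definition lipschitz01 :: "real \<Rightarrow> (real \<Rightarrow> real) \<Rightarrow> bool" where
  "lipschitz01 L u \<longleftrightarrow> L \<ge> 0 \<and> (\<forall>x\<in>{0..1}. \<forall>y\<in>{0..1}. \<bar>u x - u y\<bar> \<le> L * \<bar>x - y\<bar>)"

lemma lipschitz01_imp_continuous:
  assumes "lipschitz01 L u" shows "continuous_on {0..1} u"
proof -
  have "L-lipschitz_on {0..1} u"
    using assms by (intro lipschitz_onI) (auto simp: lipschitz01_def dist_real_def)
  then show ?thesis by (rule lipschitz_on_continuous_on)
qed

lemma bounded01:
  assumes "continuous_on {0..1} (u :: real \<Rightarrow> real)"
  obtains M where "M > 0" "\<And>x. x \<in> {0..1} \<Longrightarrow> \<bar>u x\<bar> \<le> M"
proof -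
  have "bounded (u ` {0..1})"
    using assms by (intro compact_imp_bounded compact_continuous_image) auto
  then obtain M where "M > 0" "\<And>y. y \<in> u ` {0..1} \<Longrightarrow> norm y \<le> M" unfolding bounded_pos by blast
  then show thesis using that by auto
qed

text \<open>Each averaging gains one order of smoothness at no cost in the Hoelder constant; the last conclusion is
  what a second averaging gains.\<close>

lemma steklov_approximation:
  assumes u: "holder_ball b c u" and b: "0 \<le> b" and c: "0 \<le> c" and e: "0 < e"
  obtains v v' where "\<And>x. x \<in> {0..1} \<Longrightarrow> (v has_real_derivative v' x) (at x within {0..1})"
    "holder_ball b c v" "\<And>x. x \<in> {0..1} \<Longrightarrow> \<bar>v x - u x\<bar> < e" "\<exists>L. lipschitz01 L v"
    "\<And>L. lipschitz01 L u \<Longrightarrow> \<exists>L'. lipschitz01 L' v'"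
proof -
  have cu: "continuous_on {0..1} u" using u by (simp add: holder_ball_def)
  obtain F where F: "\<And>x. x \<in> {0..1} \<Longrightarrow> (F has_real_derivative u x) (at x within {0..1})"
    using antiderivative01[OF cu] by blast
  obtain M where M: "M > 0" "\<And>x. x \<in> {0..1} \<Longrightarrow> \<bar>u x\<bar> \<le> M" using bounded01[OF cu] by blast
  have "uniformly_continuous_on {0..1} u" using cu by (intro compact_uniformly_continuous) auto
  then obtain \<delta> where \<delta>: "\<delta> > 0"
    "\<And>x y. x \<in> {0..1} \<Longrightarrow> y \<in> {0..1} \<Longrightarrow> \<bar>y - x\<bar> < \<delta> \<Longrightarrow> \<bar>u y - u x\<bar> < e"
    unfolding uniformly_continuous_on_def dist_real_def using e by meson
  define d where "d = min (\<delta> / 2) (1 / 2)"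
  have d: "0 < d" "d < 1" "d < \<delta>" using \<delta> by (auto simp: d_def)
  define v where "v = steklov d F"
  define v' where "v' x = (1 - d) / d * (u ((1 - d) * x + d) - u ((1 - d) * x))" for x
  have v: "(v has_real_derivative v' x) (at x within {0..1})" if "x \<in> {0..1}" for x
    unfolding v_def v'_def by (rule steklov_has_derivative[OF F d(1,2) that])
  have pt: "(1 - d) * x + d \<in> {0..1}" "(1 - d) * x \<in> {0..1}" if "x \<in> {0..1}" for x
    using steklov_point[OF d(1,2) that, of 0] steklov_point[OF d(1,2) that, of d] d by auto
  have "\<bar>v' x\<bar> \<le> (1 - d) / d * (2 * M)" if "x \<in> {0..1}" for x
  proof -
    have "\<bar>u ((1 - d) * x + d) - u ((1 - d) * x)\<bar> \<le> 2 * M"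
      using M(2)[OF pt(1)[OF that]] M(2)[OF pt(2)[OF that]] by linarith
    then show ?thesis unfolding v'_def abs_mult using d by (intro mult_mono) auto
  qed
  then have Lv: "lipschitz01 ((1 - d) / d * (2 * M)) v"
    unfolding lipschitz01_def using d M(1)
    by (intro conjI ballI lipschitz_of_deriv_bound[of v v', OF v]) auto
  show thesis
  proof (rule that[of v v', OF v])
    show "\<exists>L. lipschitz01 L v" using Lv by blast
    show "holder_ball b c v" unfolding holder_ball_def
    proof (intro conjI impI ballI)
      show "continuous_on {0..1} v" by (rule lipschitz01_imp_continuous[OF Lv])
      fix x y :: real assume "b \<noteq> 0" and xy: "x \<in> {0..1}" "y \<in> {0..1}"
      obtain t where t: "t \<in> {0..d}" "v x - v y = u ((1 - d) * x + t) - u ((1 - d) * y + t)"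
        using steklov_diff_eq[OF F d(1,2) xy] unfolding v_def by blast
      have "\<bar>v x - v y\<bar> \<le> c * \<bar>((1 - d) * x + t) - ((1 - d) * y + t)\<bar> powr b"
        using u steklov_point[OF d(1,2) xy(1) t(1)] steklov_point[OF d(1,2) xy(2) t(1)] \<open>b \<noteq> 0\<close>
        unfolding holder_ball_def t(2) by blast
      also have "((1 - d) * x + t) - ((1 - d) * y + t) = (1 - d) * (x - y)" by (simp add: algebra_simps)
      also have "c * \<bar>(1 - d) * (x - y)\<bar> powr b \<le> c * \<bar>x - y\<bar> powr b"
        using b c d by (intro mult_left_mono powr_mono2) (auto simp: abs_mult mult_left_le_one_le)
      finally show "\<bar>v x - v y\<bar> \<le> c * \<bar>x - y\<bar> powr b" .
    qed
    show "\<bar>v x - u x\<bar> < e" if x: "x \<in> {0..1}" for x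
    proof -
      obtain t where "t \<in> {0..1}" "\<bar>t - x\<bar> \<le> d" "v x = u t"
        using steklov_eq[OF F d(1,2) x] unfolding v_def by blast
      then show ?thesis using \<delta>(2)[OF x, of t] d by auto
    qed
    show "\<exists>L'. lipschitz01 L' v'" if L: "lipschitz01 L u" for L
    proof (rule exI, unfold lipschitz01_def, intro conjI ballI)
      have L0: "L \<ge> 0" using L by (simp add: lipschitz01_def)
      then show "(1 - d) / d * (2 * L) \<ge> 0" using d by auto
      fix x y :: real assume xy: "x \<in> {0..1}" "y \<in> {0..1}"
      have 1: "\<bar>(1 - d) * (x - y)\<bar> \<le> \<bar>x - y\<bar>"
        using d by (auto simp: abs_mult mult_left_le_one_le)
      have "\<bar>u ((1 - d) * x + d) - u ((1 - d) * y + d)\<bar> \<le> L * \<bar>(1 - d) * (x - y)\<bar>"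
        "\<bar>u ((1 - d) * x) - u ((1 - d) * y)\<bar> \<le> L * \<bar>(1 - d) * (x - y)\<bar>"
        using L[unfolded lipschitz01_def, THEN conjunct2, rule_format, OF pt(1)[OF xy(1)] pt(1)[OF xy(2)]]
          L[unfolded lipschitz01_def, THEN conjunct2, rule_format, OF pt(2)[OF xy(1)] pt(2)[OF xy(2)]]
        by (simp_all add: right_diff_distrib)
      moreover have "L * \<bar>(1 - d) * (x - y)\<bar> \<le> L * \<bar>x - y\<bar>" using 1 L0 by (rule mult_left_mono)
      ultimately have "\<bar>(u ((1 - d) * x + d) - u ((1 - d) * x)) - (u ((1 - d) * y + d) - u ((1 - d) * y))\<bar>
          \<le> 2 * L * \<bar>x - y\<bar>" by linarith
      then have "(1 - d) / d * \<bar>(u ((1 - d) * x + d) - u ((1 - d) * x)) - (u ((1 - d) * y + d) - u ((1 - d) * y))\<bar>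
          \<le> (1 - d) / d * (2 * L * \<bar>x - y\<bar>)" using d by (intro mult_left_mono) auto
      then show "\<bar>v' x - v' y\<bar> \<le> (1 - d) / d * (2 * L) * \<bar>x - y\<bar>"
        unfolding v'_def right_diff_distrib[symmetric] abs_mult using d by (simp add: mult.assoc)
    qed
  qed auto
qed

text \<open>Shrinking towards \<open>0\<close> before averaging leaves room inside the unit Hoelder ball for a
  later perturbation.\<close>

lemma lipschitz_approximation:
  assumes u: "holder_ball b 1 u" and b: "0 \<le> b" and e: "0 < e"
  obtains c v v' L where "0 \<le> c" "c < 1"
    "\<And>x. x \<in> {0..1} \<Longrightarrow> (v has_real_derivative v' x) (at x within {0..1})"
    "holder_ball b c v" "\<And>x. x \<in> {0..1} \<Longrightarrow> \<bar>v x - u x\<bar> < e" "lipschitz01 L v"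
proof -
  obtain M where M: "M > 0" "\<And>x. x \<in> {0..1} \<Longrightarrow> \<bar>u x\<bar> \<le> M"
    using bounded01[of u] u by (auto simp: holder_ball_def)
  define c where "c = 1 - min 1 (e / (2 * M))"
  have c: "0 \<le> c" "c < 1" "(1 - c) * M \<le> e / 2"
    using M e by (auto simp: c_def min_def field_simps)
  have "holder_ball b c (\<lambda>x. c * u x)"
    using holder_ball_add_scaled[OF u u, of c 0] c by simp
  from steklov_approximation[OF this b c(1), of "e / 2"] e obtain v v' L where
    v: "\<And>x. x \<in> {0..1} \<Longrightarrow> (v has_real_derivative v' x) (at x within {0..1})"
    "holder_ball b c v" "\<And>x. x \<in> {0..1} \<Longrightarrow> \<bar>v x - c * u x\<bar> < e / 2" "lipschitz01 L v"
    by (metis half_gt_zero)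
  have "\<bar>v x - u x\<bar> < e" if "x \<in> {0..1}" for x
  proof -
    have "\<bar>c * u x - u x\<bar> = \<bar>c - 1\<bar> * \<bar>u x\<bar>"
      unfolding abs_mult[symmetric] by (simp add: left_diff_distrib)
    also have "\<dots> = (1 - c) * \<bar>u x\<bar>" using c by simp
    also have "\<dots> \<le> (1 - c) * M" using M(2)[OF that] c by (intro mult_left_mono) auto
    finally show ?thesis using v(3)[OF that] c(3) by linarith
  qed
  then show thesis using that[of c v v' L] c v by blast
qed

text \<open>A first average is Lipschitz, hence a second one has a Lipschitz derivative.\<close>

lemma smooth_approximation:
  assumes u: "holder_ball b 1 u" and b: "0 \<le> b" and e: "0 < e"
  obtains c v v' L where "0 \<le> c" "c < 1"
    "\<And>x. x \<in> {0..1} \<Longrightarrow> (v has_real_derivative v' x) (at x within {0..1})"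
    "holder_ball b c v" "\<And>x. x \<in> {0..1} \<Longrightarrow> \<bar>v x - u x\<bar> < e" "lipschitz01 L v'"
proof -
  have e2: "e / 2 > 0" using e by simp
  from lipschitz_approximation[OF u b e2] obtain c w w' L where
    w: "0 \<le> c" "c < 1" "holder_ball b c w" "\<And>x. x \<in> {0..1} \<Longrightarrow> \<bar>w x - u x\<bar> < e / 2" "lipschitz01 L w"
    by metis
  from steklov_approximation[OF w(3) b w(1) e2] w(5) obtain v v' L' where
    v: "\<And>x. x \<in> {0..1} \<Longrightarrow> (v has_real_derivative v' x) (at x within {0..1})"
    "holder_ball b c v" "\<And>x. x \<in> {0..1} \<Longrightarrow> \<bar>v x - w x\<bar> < e / 2" "lipschitz01 L' v'"
    by metis
  have "\<bar>v x - u x\<bar> < e" if "x \<in> {0..1}" for x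
    using v(3)[OF that] w(4)[OF that] by linarith
  then show thesis using that[of c v v' L'] w v by blast
qed

section \<open>A sawtooth with long falls and short rises\<close>

text \<open>The negated sawtooth is a lower envelope of V-shaped branches with vertices at the points \<open>i / N\<close>, of
  slope \<open>S\<close> to the right and \<open>- S / (N * r)\<close> to the left of the vertex. As an envelope it inherits the
  Lipschitz constant of the branches. The steep slope is chosen so that on each period it takes less than
  the length \<open>r\<close> to return to \<open>0\<close>.\<close>

definition tooth_branch :: "nat \<Rightarrow> real \<Rightarrow> real \<Rightarrow> real \<Rightarrow> nat \<Rightarrow> real" where
  "tooth_branch N r S x i =
     max (S * (x - real i / real N)) (S / (real N * r) * (real i / real N - x))"

definition sawtooth :: "nat \<Rightarrow> real \<Rightarrow> real \<Rightarrow> real \<Rightarrow> real" where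
  "sawtooth N r S x = - Min (tooth_branch N r S x ` {..N})"

context
  fixes N :: nat and r S :: real
  assumes N: "N > 0" and r: "0 < r" "r \<le> 1 / real N" and S: "S > 0"
begin

lemma sawtooth_le: "i \<le> N \<Longrightarrow> - sawtooth N r S x \<le> tooth_branch N r S x i"
  unfolding sawtooth_def minus_minus by (intro Min_le) auto

lemma sawtooth_attained:
  obtains i where "i \<le> N" "- sawtooth N r S x = tooth_branch N r S x i"
proof -
  have "Min (tooth_branch N r S x ` {..N}) \<in> tooth_branch N r S x ` {..N}" by (rule Min_in) auto
  then show thesis using that unfolding sawtooth_def minus_minus by (metis atMost_iff imageE)
qed

lemma sawtooth_rise_steep: "S \<le> S / (real N * r)"
proof -
  have "real N * r \<le> 1" using r N by (simp add: field_simps)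
  then have "S * (real N * r) \<le> S * 1" using S by (intro mult_left_mono) auto
  then show ?thesis using r N by (simp add: pos_le_divide_eq)
qed

lemma sawtooth_lipschitz: "\<bar>sawtooth N r S x - sawtooth N r S y\<bar> \<le> S / (real N * r) * \<bar>x - y\<bar>"
proof -
  let ?\<Lambda> = "S / (real N * r)"
  have *: "- sawtooth N r S x \<le> - sawtooth N r S y + ?\<Lambda> * \<bar>x - y\<bar>" for x y
  proof -
    obtain i where i: "i \<le> N" "- sawtooth N r S y = tooth_branch N r S y i"
      using sawtooth_attained[of y] by blast
    have "S * (x - y) \<le> S * \<bar>x - y\<bar>" using S by (intro mult_left_mono) auto
    also have "\<dots> \<le> ?\<Lambda> * \<bar>x - y\<bar>" by (rule mult_right_mono[OF sawtooth_rise_steep]) simp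
    finally have 1: "S * (x - real i / real N) \<le> S * (y - real i / real N) + ?\<Lambda> * \<bar>x - y\<bar>"
      unfolding right_diff_distrib by linarith
    have "?\<Lambda> * (real i / real N - x) \<le> ?\<Lambda> * ((real i / real N - y) + \<bar>x - y\<bar>)"
      using S N r by (intro mult_left_mono) auto
    then have 2: "?\<Lambda> * (real i / real N - x) \<le> ?\<Lambda> * (real i / real N - y) + ?\<Lambda> * \<bar>x - y\<bar>"
      by (simp only: distrib_left)
    have "tooth_branch N r S x i \<le> tooth_branch N r S y i + ?\<Lambda> * \<bar>x - y\<bar>"
      using 1 2 unfolding tooth_branch_def by (simp only: max_def) (auto split: if_splits)
    then show ?thesis using sawtooth_le[OF i(1), of x] i(2) by linarith
  qed
  show ?thesis using *[of x y] *[of y x] by (simp add: abs_minus_commute abs_le_iff)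
qed

text \<open>To the right of its vertex the branch \<open>i\<close> lies below those of smaller index, and as long as \<open>x\<close> keeps
  the distance \<open>r\<close> from the next vertex, the branches of larger index are at least \<open>S / N\<close>, the most that
  branch \<open>i\<close> can reach on its period.\<close>

lemma sawtooth_fall:
  assumes i: "i < N" and x: "x \<in> {real i / real N .. real (Suc i) / real N - r}"
  shows "sawtooth N r S x = - (S * (x - real i / real N))"
proof -
  let ?\<Lambda> = "S / (real N * r)"
  have \<Lambda>: "?\<Lambda> > 0" using S N r by simp
  have "?\<Lambda> * (real i / real N - x) \<le> 0" "0 \<le> S * (x - real i / real N)"
    using x S less_imp_le[OF \<Lambda>] by (intro mult_nonneg_nonpos mult_nonneg_nonneg; simp)+
  then have "- sawtooth N r S x \<le> S * (x - real i / real N)"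
    using sawtooth_le[of i x] i unfolding tooth_branch_def by simp
  moreover have "S * (x - real i / real N) \<le> - sawtooth N r S x"
  proof -
    obtain j where j: "j \<le> N" "- sawtooth N r S x = tooth_branch N r S x j"
      using sawtooth_attained[of x] by blast
    show ?thesis
    proof (cases "j \<le> i")
      case True
      then have "real j / real N \<le> real i / real N" by (simp add: divide_right_mono)
      then have "S * (x - real i / real N) \<le> S * (x - real j / real N)"
        using S by (intro mult_left_mono) auto
      then show ?thesis unfolding j(2) tooth_branch_def by simp
    next
      case False
      then have "real (Suc i) / real N \<le> real j / real N" by (intro divide_right_mono) auto
      then have "r \<le> real j / real N - x" using x by auto
      then have "?\<Lambda> * r \<le> ?\<Lambda> * (real j / real N - x)" using \<Lambda> by (intro mult_left_mono) auto
      moreover have "?\<Lambda> * r = S * (1 / real N)" using r by simp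
      moreover have "S * (x - real i / real N) \<le> S * (1 / real N)"
        using x r S by (intro mult_left_mono) (auto simp: add_divide_distrib)
      ultimately show ?thesis unfolding j(2) tooth_branch_def by linarith
    qed
  qed
  ultimately show ?thesis by linarith
qed

lemma sawtooth_period:
  assumes "x \<in> {0..1}"
  obtains i where "i < N" "real i / real N \<le> x" "x \<le> real (Suc i) / real N"
proof (cases "x = 1")
  case True
  then show thesis using N by (intro that[of "N - 1"]) (auto simp: field_simps)
next
  case False
  then have x: "0 \<le> x" "x < 1" using assms by auto
  define i where "i = nat \<lfloor>x * real N\<rfloor>"
  have "0 \<le> x * real N" using x by simp
  then have i: "real i \<le> x * real N" "x * real N < real i + 1" unfolding i_def by linarith+
  have "x * real N < real N" using x N by simp
  with i have "i < N" by linarith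
  with i N show thesis by (intro that[of i]) (auto simp: field_simps)
qed

lemma sawtooth_range:
  assumes "x \<in> {0..1}" shows "- (S / real N) \<le> sawtooth N r S x" "sawtooth N r S x \<le> 0"
proof -
  let ?\<Lambda> = "S / (real N * r)"
  have \<Lambda>: "?\<Lambda> > 0" using S N r by simp
  obtain i where i: "i < N" "real i / real N \<le> x" "x \<le> real (Suc i) / real N"
    using sawtooth_period[OF assms] by blast
  have "?\<Lambda> * (real i / real N - x) \<le> 0"
    using i less_imp_le[OF \<Lambda>] by (intro mult_nonneg_nonpos; simp)
  moreover have "S * (x - real i / real N) \<le> S * (1 / real N)"
    using i S by (intro mult_left_mono) (auto simp: add_divide_distrib)
  moreover have "0 \<le> S * (1 / real N)" using S by simp
  ultimately have "- sawtooth N r S x \<le> S * (1 / real N)"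
    using sawtooth_le[of i x] i(1) unfolding tooth_branch_def by linarith
  then show "- (S / real N) \<le> sawtooth N r S x" by simp
  obtain j where j: "j \<le> N" "- sawtooth N r S x = tooth_branch N r S x j"
    using sawtooth_attained[of x] by blast
  have "0 \<le> S * (x - real j / real N) \<or> 0 \<le> ?\<Lambda> * (real j / real N - x)"
    using less_imp_le[OF S] less_imp_le[OF \<Lambda>] mult_nonneg_nonneg[of S "x - real j / real N"]
      mult_nonneg_nonneg[of ?\<Lambda> "real j / real N - x"] by linarith
  then show "sawtooth N r S x \<le> 0" using j(2) unfolding tooth_branch_def by linarith
qed

text \<open>This interpolates between the amplitude and the Lipschitz constant by means of
  \<open>min 1 t \<le> t powr b\<close> at \<open>t = \<bar>x - y\<bar> / r\<close>.\<close>

lemma sawtooth_holder: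
  assumes b: "0 \<le> b" "b \<le> 1"
  shows "holder_ball b (S / (real N * r powr b)) (sawtooth N r S)"
  unfolding holder_ball_def
proof (intro conjI impI ballI)
  have "lipschitz01 (S / (real N * r)) (sawtooth N r S)"
    using sawtooth_lipschitz S r N by (simp add: lipschitz01_def)
  then show "continuous_on {0..1} (sawtooth N r S)" by (rule lipschitz01_imp_continuous)
  fix x y :: real assume "b \<noteq> 0" and xy: "x \<in> {0..1}" "y \<in> {0..1}"
  define t where "t = \<bar>x - y\<bar> / r"
  have t0: "t \<ge> 0" using r by (simp add: t_def)
  have "\<bar>sawtooth N r S x - sawtooth N r S y\<bar> \<le> S / real N * min 1 t"
  proof (cases "t \<le> 1")
    case True
    then show ?thesis using sawtooth_lipschitz[of x y] by (simp add: t_def)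
  next
    case False
    then show ?thesis using sawtooth_range[OF xy(1)] sawtooth_range[OF xy(2)] by simp
  qed
  also have "\<dots> \<le> S / real N * t powr b"
  proof (intro mult_left_mono)
    show "min 1 t \<le> t powr b"
    proof (cases "t \<le> 1")
      case True
      then have "t powr 1 \<le> t powr b" using b t0 by (intro powr_mono') auto
      then show ?thesis using t0 by simp
    next
      case False
      then show ?thesis using b by (simp add: ge_one_powr_ge_zero)
    qed
  qed (use S in simp)
  also have "\<dots> = S / (real N * r powr b) * \<bar>x - y\<bar> powr b"
    using r by (simp add: t_def powr_divide)
  finally show "\<bar>sawtooth N r S x - sawtooth N r S y\<bar> \<le> S / (real N * r powr b) * \<bar>x - y\<bar> powr b" .
qed

end

section \<open>Convexity against strict concavity\<close>

text \<open>A greedy choice: the second interval starts at the infimum of what the first one misses. The infima need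
  not belong to \<open>A\<close>, but a point missed by both intervals lies strictly beyond them, which leaves room to
  replace the infima by nearby points of \<open>A\<close>.\<close>

lemma two_interval_cover:
  fixes A :: "real set"
  assumes A: "A \<subseteq> {a..b}"
    and sep: "\<And>x y z. x \<in> A \<Longrightarrow> y \<in> A \<Longrightarrow> z \<in> A \<Longrightarrow> x + r \<le> y \<Longrightarrow> y + r \<le> z \<Longrightarrow> False"
  shows "\<exists>T. finite T \<and> card T \<le> 2 \<and> A \<subseteq> (\<Union>t\<in>T. {t..t + r})"
proof (cases "A = {}")
  case True
  then show ?thesis by (intro exI[of _ "{}"]) auto
next
  case False
  have bdd: "bdd_below A" by (rule bdd_below_mono[OF _ A]) simp
  define B where "B = {x \<in> A. Inf A + r < x}"
  have bddB: "bdd_below B" using bdd by (rule bdd_below_mono) (auto simp: B_def)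
  have "A \<subseteq> (\<Union>t\<in>{Inf A, Inf B}. {t..t + r})"
  proof
    fix z assume z: "z \<in> A"
    show "z \<in> (\<Union>t\<in>{Inf A, Inf B}. {t..t + r})"
    proof (rule ccontr)
      assume neg: "\<not> ?thesis"
      have "Inf A \<le> z" using z bdd by (rule cInf_lower)
      with neg have zB: "z \<in> B" using z by (auto simp: B_def)
      then have "Inf B \<le> z" using bddB by (rule cInf_lower)
      with neg have "Inf B < z - r" by auto
      then obtain y where y: "y \<in> B" "y < z - r" using cInf_lessD[of B] zB by blast
      then have "Inf A < y - r" by (auto simp: B_def)
      then obtain x where "x \<in> A" "x < y - r" using cInf_lessD[of A] False by blast
      then show False using sep[of x y z] y z by (auto simp: B_def)
    qed
  qed
  moreover have "card {Inf A, Inf B} \<le> 2" by (simp add: card_insert_if)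
  ultimately show ?thesis by (intro exI[of _ "{Inf A, Inf B}"]) auto
qed

lemma convex_restr_subset: "convex_restr A f \<Longrightarrow> B \<subseteq> A \<Longrightarrow> convex_restr B f"
  unfolding convex_restr_def by blast

lemma concave_restr_iff: "concave_restr A f \<longleftrightarrow> convex_restr A (\<lambda>x. - 1 * f x)"
proof -
  have "(- 1 * p - - 1 * q) / c = - ((p - q) / c)" for p q c :: real
    by (simp add: diff_divide_distrib)
  then show ?thesis unfolding convex_restr_def concave_restr_def by (simp only: neg_le_iff_le)
qed

text \<open>The function \<open>g x + x\<^sup>2 / 2\<close> is still concave on the interval, and the quadratic term accounts for the
  fact that the slopes of \<open>g\<close> over consecutive gaps of length at least \<open>r\<close> drop by at least \<open>r\<close>. Passing
  from \<open>g\<close> to \<open>f\<close> changes each of the two slopes by at most \<open>2 * \<eta> / r\<close>, too little to make them increase.\<close>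

lemma near_concave_cover:
  assumes g: "\<And>x. x \<in> {0..1} \<Longrightarrow> (g has_real_derivative g' x) (at x within {0..1})"
    and ab: "0 \<le> a" "b \<le> 1"
    and decr: "\<And>x y. a \<le> x \<Longrightarrow> x \<le> y \<Longrightarrow> y \<le> b \<Longrightarrow> g' y - g' x \<le> - (y - x)"
    and r: "0 < r" "4 * \<eta> < r\<^sup>2"
    and close: "\<And>x. x \<in> {0..1} \<Longrightarrow> \<bar>f x - g x\<bar> \<le> \<eta>"
    and A: "A \<subseteq> {a..b}" "convex_restr A f"
  shows "\<exists>T. finite T \<and> card T \<le> 2 \<and> A \<subseteq> (\<Union>t\<in>T. {t..t + r})"
proof (rule two_interval_cover[OF A(1)])
  fix x y z assume xyz: "x \<in> A" "y \<in> A" "z \<in> A" and sep: "x + r \<le> y" "y + r \<le> z"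
  have I: "a \<le> x" "z \<le> b" "x < y" "y < z" "0 \<le> x" "z \<le> 1" using A(1) xyz sep r ab by auto
  define G where "G x = g x + x\<^sup>2 / 2" for x
  have G: "(G has_real_derivative g' x + x) (at x within {0..1})" if "x \<in> {0..1}" for x
    unfolding G_def[abs_def] by (auto intro!: derivative_eq_intros g[OF that])
  from mean_value01[of G "\<lambda>x. g' x + x" x y, OF G] I obtain s where
    s: "s \<in> {x..y}" "G y - G x = (g' s + s) * (y - x)" by auto
  from mean_value01[of G "\<lambda>x. g' x + x" y z, OF G] I obtain t where
    t: "t \<in> {y..z}" "G z - G y = (g' t + t) * (z - y)" by auto
  have mono: "g' t + t \<le> g' s + s" using decr[of s t] s t I by auto
  have quot: "(g w - g v) / (w - v) = (G w - G v) / (w - v) - (v + w) / 2" if "v < w" for v w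
    using that by (simp add: G_def field_simps power2_eq_square)
  have E1: "(g y - g x) / (y - x) = g' s + s - (x + y) / 2"
    using s(2) I by (subst quot) auto
  have E2: "(g z - g y) / (z - y) = g' t + t - (y + z) / 2"
    using t(2) I by (subst quot) auto
  have gap: "(g y - g x) / (y - x) - (g z - g y) / (z - y) \<ge> r"
    unfolding E1 E2 using mono sep by argo
  have \<eta>: "0 \<le> \<eta>" using close[of 0] by auto
  have near: "\<bar>(f w - f v) / (w - v) - (g w - g v) / (w - v)\<bar> \<le> 2 * \<eta> / r"
    if "v + r \<le> w" "v \<in> {0..1}" "w \<in> {0..1}" for v w
  proof -
    have "(f w - f v) / (w - v) - (g w - g v) / (w - v) = ((f w - g w) - (f v - g v)) / (w - v)"
      by (simp add: diff_divide_distrib)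
    then have "\<bar>(f w - f v) / (w - v) - (g w - g v) / (w - v)\<bar> = \<bar>(f w - g w) - (f v - g v)\<bar> / (w - v)"
      using that r by (simp add: abs_divide)
    also have "\<dots> \<le> (2 * \<eta>) / r"
      using close[of v] close[of w] that r \<eta> by (intro frac_le) auto
    finally show ?thesis .
  qed
  have "(f y - f x) / (y - x) \<le> (f z - f y) / (z - y)"
    using A(2) xyz I unfolding convex_restr_def by blast
  moreover have "x \<in> {0..1}" "y \<in> {0..1}" "z \<in> {0..1}" using I by auto
  ultimately have "r \<le> 2 * \<eta> / r + 2 * \<eta> / r"
    using near[of x y] near[of y z] gap sep unfolding abs_le_iff by linarith
  then have "r \<le> 4 * \<eta> / r" by (simp add: add_divide_distrib[symmetric])
  then have "r * r \<le> 4 * \<eta>" using r by (simp add: pos_le_divide_eq)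
  then show False using r by (simp add: power2_eq_square)
qed

text \<open>On every falling segment the slope \<open>- (L + 1)\<close> of the sawtooth outweighs the variation of \<open>h'\<close>, so
  \<open>s * h + p\<close> is strictly concave there, which costs two intervals; the remaining part of the same period
  has length \<open>r\<close> and costs a third.\<close>

lemma near_sawtooth_cover:
  assumes h: "\<And>x. x \<in> {0..1} \<Longrightarrow> (h has_real_derivative h' x) (at x within {0..1})"
    and L: "lipschitz01 L h'" and s: "\<bar>s\<bar> = 1"
    and N: "N > 0" and r: "0 < r" "r \<le> 1 / real N"
    and p: "\<And>x. x \<in> {0..1} \<Longrightarrow> (p has_real_derivative sawtooth N r (L + 1) x) (at x within {0..1})"
    and \<eta>: "4 * \<eta> < r\<^sup>2" and close: "\<And>x. x \<in> {0..1} \<Longrightarrow> \<bar>f x - (h x + s * p x)\<bar> \<le> \<eta>"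
    and A: "A \<subseteq> {0..1}" "convex_restr A (\<lambda>x. s * f x)"
  shows "\<exists>T. finite T \<and> card T \<le> 3 * N \<and> A \<subseteq> (\<Union>t\<in>T. {t..t + r})"
proof -
  have L0: "0 \<le> L" using L by (simp add: lipschitz01_def)
  have ss: "s * s = 1" using s by (metis abs_mult_self_eq mult_1)
  define J where "J i = {real i / real N .. real (Suc i) / real N - r}" for i
  have "\<exists>T. finite T \<and> card T \<le> 2 \<and> A \<inter> J i \<subseteq> (\<Union>t\<in>T. {t..t + r})" if i: "i < N" for i
  proof (rule near_concave_cover)
    show "((\<lambda>x. s * h x + p x) has_real_derivative s * h' x + sawtooth N r (L + 1) x) (at x within {0..1})"
      if "x \<in> {0..1}" for x
      using h[OF that] p[OF that] by (auto intro!: derivative_eq_intros)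
    show "0 \<le> real i / real N" by simp
    have le1: "real (Suc i) / real N \<le> 1" using i by simp
    then show "real (Suc i) / real N - r \<le> 1" using r by linarith
    show "(s * h' y + sawtooth N r (L + 1) y) - (s * h' x + sawtooth N r (L + 1) x) \<le> - (y - x)"
      if xy: "real i / real N \<le> x" "x \<le> y" "y \<le> real (Suc i) / real N - r" for x y
    proof -
      have "sawtooth N r (L + 1) y = - ((L + 1) * (y - real i / real N))"
        "sawtooth N r (L + 1) x = - ((L + 1) * (x - real i / real N))"
        using xy L0 by (intro sawtooth_fall[OF N r _ i]; simp)+
      then have 1: "sawtooth N r (L + 1) y - sawtooth N r (L + 1) x = - (L * (y - x)) - (y - x)"
        by (simp add: algebra_simps)
      have "0 \<le> x" by (rule order_trans[OF _ xy(1)]) simp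
      then have "x \<in> {0..1}" "y \<in> {0..1}" using xy r le1 by auto
      then have "\<bar>h' y - h' x\<bar> \<le> L * \<bar>y - x\<bar>" using L by (auto simp: lipschitz01_def)
      then have "\<bar>s * (h' y - h' x)\<bar> \<le> L * (y - x)" using s xy by (simp add: abs_mult)
      then show ?thesis using 1 by (simp add: right_diff_distrib)
    qed
    show "0 < r" "4 * \<eta> < r\<^sup>2" by fact+
    show "\<bar>s * f x - (s * h x + p x)\<bar> \<le> \<eta>" if "x \<in> {0..1}" for x
    proof -
      have "s * f x - (s * h x + p x) = s * f x - (s * h x + (s * s) * p x)" by (simp add: ss)
      also have "\<dots> = s * (f x - (h x + s * p x))" by (simp add: algebra_simps)
      finally show ?thesis using close[OF that] s by (simp add: abs_mult)
    qed
    show "A \<inter> J i \<subseteq> {real i / real N .. real (Suc i) / real N - r}" by (simp add: J_def)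
    show "convex_restr (A \<inter> J i) (\<lambda>x. s * f x)" by (rule convex_restr_subset[OF A(2)]) simp
  qed
  then obtain T where T: "\<And>i. i < N \<Longrightarrow> finite (T i)" "\<And>i. i < N \<Longrightarrow> card (T i) \<le> 2"
    "\<And>i. i < N \<Longrightarrow> A \<inter> J i \<subseteq> (\<Union>t\<in>T i. {t..t + r})" by metis
  define U where "U i = insert (real (Suc i) / real N - r) (T i)" for i
  have U: "finite (U i)" "card (U i) \<le> 3" if "i < N" for i
    using T(1,2)[OF that] by (auto simp: U_def card_insert_if)
  have "finite (\<Union>i<N. U i)" using U by auto
  moreover have "card (\<Union>i<N. U i) \<le> (\<Sum>i<N. card (U i))" by (rule card_UN_le) simp
  moreover have "(\<Sum>i<N. card (U i)) \<le> (\<Sum>i<N. 3)" using U by (intro sum_mono) simp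
  moreover have "A \<subseteq> (\<Union>t\<in>(\<Union>i<N. U i). {t..t + r})"
  proof
    fix x assume x: "x \<in> A"
    then have "x \<in> {0..1}" "0 < L + 1" using A(1) L0 by auto
    then obtain i where i: "i < N" "real i / real N \<le> x" "x \<le> real (Suc i) / real N"
      using sawtooth_period[OF N r] by blast
    have "\<exists>t\<in>U i. x \<in> {t..t + r}"
    proof (cases "x \<in> J i")
      case True
      then show ?thesis using T(3)[OF i(1)] x unfolding U_def by blast
    next
      case False
      then show ?thesis using i by (intro bexI[of _ "real (Suc i) / real N - r"]) (auto simp: J_def U_def)
    qed
    then show "x \<in> (\<Union>t\<in>(\<Union>i<N. U i). {t..t + r})" using i(1) by blast
  qed
  ultimately show ?thesis by (intro exI[of _ "\<Union>i<N. U i"]) auto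
qed

section \<open>Density of the well-coverable functions\<close>

text \<open>The sign \<open>s\<close> selects convexity or concavity. The single parameter \<open>t\<close> bounds both the scale and the
  excess of the exponent over \<open>b\<close>, so that \<open>t = 1 / Suc n\<close> gives a countable family of conditions.\<close>

definition coverable :: "real \<Rightarrow> real \<Rightarrow> real \<Rightarrow> (real \<Rightarrow> real) \<Rightarrow> bool" where
  "coverable b t s f \<longleftrightarrow> (\<exists>r M. 0 < r \<and> r < t \<and> real M \<le> r powr (- (b + t)) \<and>
     (\<forall>A\<subseteq>{0..1}. convex_restr A (\<lambda>x. s * f x) \<longrightarrow>
        (\<exists>T. finite T \<and> card T \<le> M \<and> A \<subseteq> (\<Union>x\<in>T. {x..x + r}))))"

text \<open>The number \<open>N\<close> is \<open>K * r powr - b\<close> rounded up. Fitting \<open>N\<close> teeth with rises of length \<open>r\<close> into the unit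
  interval needs \<open>N * r \<le> 1\<close>, which holds for small \<open>r\<close> because \<open>b < 1\<close>; constant factors are absorbed by
  \<open>r powr - t\<close>.\<close>

lemma scale_choice:
  fixes b K t :: real
  assumes b: "0 \<le> b" "b < 1" and K: "K > 0" and t: "t > 0"
  obtains r N where "0 < r" "r < t" "N > 0" "r \<le> 1 / real N"
    "K \<le> real N * r powr b" "3 * real N \<le> r powr (- (b + t))" "r < 1"
proof -
  have z: "((\<lambda>r. r powr c) \<longlongrightarrow> (0::real)) (at_right 0)" if "c > 0" for c
    by (rule tendsto_zero_powrI[OF tendsto_ident_at tendsto_const])
      (use that in \<open>auto simp: eventually_at_filter\<close>)
  have "((\<lambda>r. (K + 1) * r powr (1 - b)) \<longlongrightarrow> (K + 1) * 0) (at_right 0)"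
    using b by (intro tendsto_intros z) auto
  then have e1: "\<forall>\<^sub>F r in at_right 0. (K + 1) * r powr (1 - b) < 1"
    by (rule order_tendstoD) simp
  have "((\<lambda>r. 3 * (K + 1) * r powr t) \<longlongrightarrow> 3 * (K + 1) * 0) (at_right 0)"
    using t by (intro tendsto_intros z) auto
  then have e2: "\<forall>\<^sub>F r in at_right 0. 3 * (K + 1) * r powr t < 1"
    by (rule order_tendstoD) simp
  have e3: "\<forall>\<^sub>F r in at_right (0::real). 0 < r \<and> r < min t 1"
    using t eventually_at_right_real[of 0 "min t 1"] by (auto elim: eventually_mono)
  from e1 e2 e3 have "\<forall>\<^sub>F r in at_right (0::real). (K + 1) * r powr (1 - b) < 1 \<and> 3 * (K + 1) * r powr t < 1 \<and> 0 < r \<and> r < min t 1"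
    by eventually_elim simp
  then obtain r where r: "(K + 1) * r powr (1 - b) < 1" "3 * (K + 1) * r powr t < 1" "0 < r" "r < min t 1"
    using eventually_happens[of _ "at_right (0::real)"] by force
  define N where "N = nat \<lceil>K * r powr (- b)\<rceil>"
  have pos: "K * r powr (- b) > 0" using K r by simp
  have ge1: "1 \<le> r powr (- b)"
    using r b by (simp add: powr_minus one_le_inverse_iff powr_le1)
  have N: "K * r powr (- b) \<le> real N" "real N \<le> K * r powr (- b) + 1"
    using pos unfolding N_def by linarith+
  have N2: "real N \<le> (K + 1) * r powr (- b)" using N ge1 by (simp add: distrib_right)
  have N0: "N > 0" using pos N by (cases "N = 0") auto
  show thesis
  proof (rule that[of r N])
    show "0 < r" "r < t" "r < 1" using r by auto
    show "N > 0" by fact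
    have "real N * r \<le> (K + 1) * r powr (- b) * r" using N2 r by (intro mult_right_mono) auto
    also have "\<dots> = (K + 1) * r powr (1 - b)" using r by (simp add: powr_diff powr_minus_divide)
    finally have "real N * r \<le> 1" using r by linarith
    then show "r \<le> 1 / real N" using N0 by (simp add: field_simps)
    have "K = K * r powr (- b) * r powr b" using r by (simp add: mult.assoc powr_add[symmetric])
    also have "\<dots> \<le> real N * r powr b" using N by (intro mult_right_mono) auto
    finally show "K \<le> real N * r powr b" .
    have "3 * real N \<le> 3 * (K + 1) * r powr t * r powr (- (b + t))"
    proof -
      have "3 * (K + 1) * r powr t * r powr (- (b + t)) = 3 * ((K + 1) * r powr (- b))"
        using r by (simp add: mult.assoc powr_add[symmetric])
      then show ?thesis using N2 by linarith
    qed
    also have "\<dots> \<le> 1 * r powr (- (b + t))" using r by (intro mult_right_mono) auto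
    finally show "3 * real N \<le> r powr (- (b + t))" by simp
  qed
qed

text \<open>For \<open>\<alpha> \<ge> 1\<close> it is the derivative that is smoothed, once, and then integrated with the initial value
  \<open>f 0\<close>.\<close>

lemma smooth_approximation_X:
  assumes a: "0 \<le> \<alpha>" and f: "f \<in> X_space \<alpha>" and e: "e > 0"
  obtains c h h' L where "0 \<le> c" "c < 1"
    "\<And>x. x \<in> {0..1} \<Longrightarrow> (h has_real_derivative h' x) (at x within {0..1})"
    "lipschitz01 L h'" "\<And>x. x \<in> {0..1} \<Longrightarrow> \<bar>h x - f x\<bar> \<le> e"
    "\<alpha> < 1 \<Longrightarrow> holder_ball \<alpha> c h" "1 \<le> \<alpha> \<Longrightarrow> holder_ball (\<alpha> - 1) c h'"
    "\<And>x. 1 \<le> \<alpha> \<Longrightarrow> x \<in> {0..1} \<Longrightarrow> \<bar>h' x - deriv01 f x\<bar> \<le> e"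
proof (cases "\<alpha> < 1")
  case True
  then have "holder_ball \<alpha> 1 f" using a f by (simp add: X_space_less_1)
  from smooth_approximation[OF this a e] obtain c h h' L where "0 \<le> c" "c < 1"
    "\<And>x. x \<in> {0..1} \<Longrightarrow> (h has_real_derivative h' x) (at x within {0..1})"
    "holder_ball \<alpha> c h" "\<And>x. x \<in> {0..1} \<Longrightarrow> \<bar>h x - f x\<bar> < e" "lipschitz01 L h'" by blast
  then show thesis using True by (intro that[of c h h' L]) (auto intro: less_imp_le)
next
  case False
  then have a1: "1 \<le> \<alpha>" by simp
  then have "holder_ball (\<alpha> - 1) 1 (deriv01 f)" "0 \<le> \<alpha> - 1" using f by (simp_all add: X_space_ge_1)
  from lipschitz_approximation[OF this e] obtain c v L where v: "0 \<le> c" "c < 1"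
    "holder_ball (\<alpha> - 1) c v" "\<And>x. x \<in> {0..1} \<Longrightarrow> \<bar>v x - deriv01 f x\<bar> < e" "lipschitz01 L v"
    by metis
  obtain h where h: "h 0 = f 0" "\<And>x. x \<in> {0..1} \<Longrightarrow> (h has_real_derivative v x) (at x within {0..1})"
    using antiderivative01[OF lipschitz01_imp_continuous[OF v(5)]] by blast
  have "((\<lambda>x. h x - f x) has_real_derivative v x - deriv01 f x) (at x within {0..1})" if "x \<in> {0..1}" for x
    using has_vector_derivative_deriv01[OF X_space_differentiable[OF f a1] that]
    unfolding has_real_derivative_iff_has_vector_derivative[symmetric] by (intro DERIV_diff h that)
  from lipschitz_of_deriv_bound[of "\<lambda>x. h x - f x", OF this, of e _ 0] v(4)
  have close: "\<bar>h x - f x\<bar> \<le> e * \<bar>x\<bar>" if "x \<in> {0..1}" for x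
    using that h(1) by (force intro: less_imp_le)
  have "\<bar>h x - f x\<bar> \<le> e" if "x \<in> {0..1}" for x
  proof -
    have "e * \<bar>x\<bar> \<le> e" using that e by (intro mult_left_le) auto
    then show ?thesis using close[OF that] by linarith
  qed
  then show thesis using h(2) v a1 by (intro that[of c h v L]) (auto intro: less_imp_le)
qed

text \<open>The centre of the ball is \<open>h + s * p\<close>, where \<open>h\<close> is a smooth approximation of \<open>f\<close> and \<open>p\<close> a primitive of
  a sawtooth. For \<open>\<alpha> \<ge> 1\<close> membership in the space rests on the Hoelder constant of the sawtooth, for
  \<open>\<alpha> < 1\<close> on its amplitude alone, since this is a Lipschitz constant of \<open>p\<close>.\<close>

lemma coverable_ball_dense:
  assumes a: "0 \<le> \<alpha>" "\<alpha> < 2" and f: "f \<in> X_space \<alpha>" and e: "e > 0" and t: "t > 0" and s: "\<bar>s\<bar> = 1"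
  obtains g \<eta> where "g \<in> X_space \<alpha>" "X_dist \<alpha> f g < e" "\<eta> > 0"
    "\<And>k. k \<in> X_space \<alpha> \<Longrightarrow> X_dist \<alpha> g k < \<eta> \<Longrightarrow> coverable (max 0 (\<alpha> - 1)) t s k"
proof -
  define b where "b = max 0 (\<alpha> - 1)"
  have b: "0 \<le> b" "b < 1" using a by (auto simp: b_def)
  have e3: "e / 3 > 0" using e by simp
  from smooth_approximation_X[OF a(1) f e3] obtain c h h' L where c: "0 \<le> c" "c < 1"
    and h: "\<And>x. x \<in> {0..1} \<Longrightarrow> (h has_real_derivative h' x) (at x within {0..1})"
    and L: "lipschitz01 L h'" and hf: "\<And>x. x \<in> {0..1} \<Longrightarrow> \<bar>h x - f x\<bar> \<le> e / 3"
    and hlow: "\<alpha> < 1 \<Longrightarrow> holder_ball \<alpha> c h" and hhigh: "1 \<le> \<alpha> \<Longrightarrow> holder_ball (\<alpha> - 1) c h'"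
    and hf': "\<And>x. 1 \<le> \<alpha> \<Longrightarrow> x \<in> {0..1} \<Longrightarrow> \<bar>h' x - deriv01 f x\<bar> \<le> e / 3" by metis
  \<comment> \<open>The room left for the perturbation by the distance and by the Hoelder constant.\<close>
  define \<epsilon> where "\<epsilon> = min (e / 3) (1 - c)"
  have \<epsilon>: "\<epsilon> > 0" "\<epsilon> \<le> e / 3" "c + \<epsilon> \<le> 1"
    using c e min.cobounded1[of "e / 3" "1 - c"] min.cobounded2[of "e / 3" "1 - c"]
    unfolding \<epsilon>_def by (simp, linarith+)
  define S where "S = L + 1"
  have S: "S > 0" using L by (simp add: S_def lipschitz01_def)
  have "S / \<epsilon> > 0" using S \<epsilon> by simp
  from scale_choice[OF b this t] obtain r N where
    r: "0 < r" "r < t" "r < 1" and N: "N > 0" and rN: "r \<le> 1 / real N"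
    and SN: "S / \<epsilon> \<le> real N * r powr b" and N3: "3 * real N \<le> r powr (- (b + t))" by blast
  let ?q = "sawtooth N r S"
  have rb: "0 < r powr b" "r powr b \<le> 1" using r b by (auto intro: powr_le1)
  have S1: "S / (real N * r powr b) \<le> \<epsilon>" using SN \<epsilon> N rb by (simp add: field_simps)
  have qH: "holder_ball b \<epsilon> ?q"
    by (rule holder_ball_mono[OF sawtooth_holder[OF N r(1) rN S] S1]) (use b in auto)
  have "S / real N \<le> S / (real N * r powr b)"
    using S N rb by (intro divide_left_mono) (auto simp: mult_left_le)
  then have qb: "\<bar>?q x\<bar> \<le> \<epsilon>" if "x \<in> {0..1}" for x
    using sawtooth_range[OF N r(1) rN S that] S1 by linarith
  obtain p where p: "p 0 = 0" "\<And>x. x \<in> {0..1} \<Longrightarrow> (p has_real_derivative ?q x) (at x within {0..1})"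
    using antiderivative01[of ?q] qH unfolding holder_ball_def by blast
  have pL: "\<bar>p x - p y\<bar> \<le> \<epsilon> * \<bar>x - y\<bar>" if "x \<in> {0..1}" "y \<in> {0..1}" for x y
    using p(2) qb that by (intro lipschitz_of_deriv_bound[of p ?q]) blast+
  have pb: "\<bar>p x\<bar> \<le> \<epsilon>" if "x \<in> {0..1}" for x
  proof -
    have "\<bar>p x\<bar> \<le> \<epsilon> * \<bar>x\<bar>" using pL[of x 0] that p(1) by simp
    also have "\<dots> \<le> \<epsilon>" using that \<epsilon> by (intro mult_left_le) auto
    finally show ?thesis .
  qed
  define g where "g = restrict (\<lambda>x. h x + s * p x) {0..1}"
  have gD: "(g has_real_derivative h' x + s * ?q x) (at x within {0..1})" if x: "x \<in> {0..1}" for x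
  proof -
    have "((\<lambda>x. h x + s * p x) has_real_derivative h' x + s * ?q x) (at x within {0..1})"
      using h[OF x] p(2)[OF x] by (auto intro!: derivative_eq_intros)
    then show ?thesis
      by (rule has_field_derivative_transform_within[where d = 1]) (use x in \<open>auto simp: g_def\<close>)
  qed
  then have gd: "deriv01 g x = h' x + s * ?q x" if "x \<in> {0..1}" for x
    using that by (intro deriv01_eqI) (auto simp: has_real_derivative_iff_has_vector_derivative[symmetric])
  have gX: "g \<in> X_space \<alpha>"
  proof (cases "\<alpha> < 1")
    case True
    have "holder_ball \<alpha> \<epsilon> p" unfolding holder_ball_def
    proof (intro conjI impI ballI)
      show "continuous_on {0..1} p"
        using p(2) DERIV_continuous unfolding continuous_on_eq_continuous_within by blast
      fix x y :: real assume xy: "x \<in> {0..1}" "y \<in> {0..1}"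
      have "\<bar>x - y\<bar> powr 1 \<le> \<bar>x - y\<bar> powr \<alpha>" using xy a True by (intro powr_mono') auto
      then have "\<bar>x - y\<bar> \<le> \<bar>x - y\<bar> powr \<alpha>" by simp
      then show "\<bar>p x - p y\<bar> \<le> \<epsilon> * \<bar>x - y\<bar> powr \<alpha>"
        using pL[OF xy] mult_left_mono[of "\<bar>x - y\<bar>" "\<bar>x - y\<bar> powr \<alpha>" \<epsilon>] \<epsilon>(1) by linarith
    qed
    from holder_ball_add_scaled[OF hlow[OF True] this, of 1 s] s
    have "holder_ball \<alpha> (c + \<epsilon>) (\<lambda>x. h x + s * p x)" by simp
    then have "holder_ball \<alpha> 1 (\<lambda>x. h x + s * p x)" using \<epsilon>(3) by (rule holder_ball_mono)
    then have "holder_ball \<alpha> 1 g"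
      using holder_ball_cong[of g "\<lambda>x. h x + s * p x" \<alpha> 1] by (simp add: g_def)
    then show ?thesis using True a by (simp add: X_space_less_1 g_def)
  next
    case False
    then have a1: "1 \<le> \<alpha>" "b = \<alpha> - 1" by (auto simp: b_def)
    from holder_ball_add_scaled[OF hhigh[OF a1(1)] qH[unfolded a1(2)], of 1 s] s
    have "holder_ball (\<alpha> - 1) (c + \<epsilon>) (\<lambda>x. h' x + s * ?q x)" by simp
    then have "holder_ball (\<alpha> - 1) 1 (\<lambda>x. h' x + s * ?q x)" using \<epsilon>(3) by (rule holder_ball_mono)
    then have "holder_ball (\<alpha> - 1) 1 (deriv01 g)"
      using holder_ball_cong[of "deriv01 g" "\<lambda>x. h' x + s * ?q x" "\<alpha> - 1" 1] gd by simp
    moreover have "g differentiable_on {0..1}"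
      unfolding differentiable_on_def differentiable_def using gD[unfolded has_field_derivative_def] by blast
    ultimately show ?thesis using a1 by (simp add: X_space_ge_1 g_def)
  qed
  have "X_dist \<alpha> f g \<le> e / 3 + \<epsilon>"
  proof (rule X_dist_le[OF f gX])
    show "\<bar>f x - g x\<bar> \<le> e / 3 + \<epsilon>" if x: "x \<in> {0..1}" for x
    proof -
      have "\<bar>s * p x\<bar> \<le> \<epsilon>" using pb[OF x] s by (simp add: abs_mult)
      moreover have "f x - g x = - (h x - f x) - s * p x" using x by (simp add: g_def)
      ultimately show ?thesis using hf[OF x] by linarith
    qed
    show "\<bar>deriv01 f x - deriv01 g x\<bar> \<le> e / 3 + \<epsilon>" if x: "1 \<le> \<alpha>" "x \<in> {0..1}" for x
    proof -
      have "\<bar>s * ?q x\<bar> \<le> \<epsilon>" using qb[OF x(2)] s by (simp add: abs_mult)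
      moreover have "deriv01 f x - deriv01 g x = - (h' x - deriv01 f x) - s * ?q x"
        using gd[OF x(2)] by simp
      ultimately show ?thesis using hf'[OF x] by linarith
    qed
  qed
  then have dist: "X_dist \<alpha> f g < e" using \<epsilon> e by linarith
  show thesis
  proof (rule that[OF gX dist])
    \<comment> \<open>Any radius below \<open>r\<^sup>2 / 4\<close> would do.\<close>
    show "r\<^sup>2 / 5 > 0" using r by simp
    fix k assume k: "k \<in> X_space \<alpha>" "X_dist \<alpha> g k < r\<^sup>2 / 5"
    have close: "\<bar>k x - (h x + s * p x)\<bar> \<le> r\<^sup>2 / 5" if "x \<in> {0..1}" for x
    proof -
      have "\<bar>g x - k x\<bar> \<le> r\<^sup>2 / 5" using X_dist_bounds(1)[OF a(1) gX k(1) that] k(2) by linarith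
      moreover have "g x = h x + s * p x" using that by (simp add: g_def)
      ultimately show ?thesis by (simp add: abs_minus_commute)
    qed
    have "4 * (r\<^sup>2 / 5) < r\<^sup>2" using r by simp
    note cover = near_sawtooth_cover[OF h L s N r(1) rN p(2)[unfolded S_def] this close]
    show "coverable (max 0 (\<alpha> - 1)) t s k"
      unfolding coverable_def b_def[symmetric]
      using r N3 cover by (intro exI[of _ r] exI[of _ "3 * N"]) auto
  qed
qed

lemma lower_minkowski_dim_le_of_coverable:
  assumes b: "0 \<le> b" and cov: "\<And>n. coverable b (1 / real (Suc n)) s f"
    and A: "A \<subseteq> {0..1}" "convex_restr A (\<lambda>x. s * f x)" and k: "k \<ge> 2"
  shows "lower_minkowski_dim k A \<le> ereal b"
proof (rule lower_minkowski_dim_le_of_covers[OF k b])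
  fix t :: real assume "t > 0"
  then obtain n where n: "1 / real (Suc n) < t" using nat_approx_posE by blast
  have "1 / real (Suc n) \<le> 1" by simp
  from cov[of n] A obtain r M T where r: "0 < r" "r < 1 / real (Suc n)"
    "real M \<le> r powr (- (b + 1 / real (Suc n)))" and T: "finite T" "card T \<le> M" "A \<subseteq> (\<Union>x\<in>T. {x..x + r})"
    unfolding coverable_def by blast
  have r1: "r \<le> 1" using r(2) \<open>1 / real (Suc n) \<le> 1\<close> by linarith
  have "r powr (- (b + 1 / real (Suc n))) \<le> r powr (- (b + t))"
    using r(1) n r1 by (intro powr_mono') auto
  then show "\<exists>r T. 0 < r \<and> r < t \<and> finite T \<and> real (card T) \<le> r powr (- (b + t)) \<and>
              A \<subseteq> (\<Union>x\<in>T. {x..x + r})"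
    using r n T by (intro exI[of _ r] exI[of _ T]) auto
qed

section \<open>The residual set\<close>

theorem theorem10:
  fixes \<alpha> :: real
  assumes "0 \<le> \<alpha>" and "\<alpha> < 2"
  shows "\<exists>G. gdelta_in (X_topology \<alpha>) G \<and> (X_topology \<alpha>) closure_of G = X_space \<alpha> \<and>
           (\<forall>f\<in>G. \<forall>A\<subseteq>{0..1}. convex_restr A f \<or> concave_restr A f \<longrightarrow>
              (\<forall>k\<ge>2. hausdorff_dim A \<le> lower_minkowski_dim k A \<and>
                      lower_minkowski_dim k A \<le> ereal (max 0 (\<alpha> - 1))))"
proof -
  interpret M: Metric_space "X_space \<alpha>" "X_dist \<alpha>" by (rule Metric_space_X[OF assms(1)])
  define b where "b = max 0 (\<alpha> - 1)"
  define U where "U n s = X_topology \<alpha> interior_of {f \<in> X_space \<alpha>. coverable b (1 / real (Suc n)) s f}"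
    for n s
  have U: "openin (X_topology \<alpha>) (U n s)" for n s by (simp add: U_def)
  have Us: "U n s \<subseteq> {f \<in> X_space \<alpha>. coverable b (1 / real (Suc n)) s f}" for n s
    unfolding U_def by (rule interior_of_subset)
  have dense: "X_topology \<alpha> closure_of U n s = X_space \<alpha>" if s: "s \<in> {1, - 1}" for n s
    unfolding X_topology_def
  proof (intro equalityI subsetI)
    show "f \<in> X_space \<alpha>" if "f \<in> M.mtopology closure_of U n s" for f
      using that closure_of_subset_topspace[of M.mtopology] by auto
    fix f assume f: "f \<in> X_space \<alpha>"
    show "f \<in> M.mtopology closure_of U n s"
      unfolding M.metric_closure_of
    proof (clarify, intro conjI allI impI f)
      fix e :: real assume "e > 0"
      moreover have "0 < 1 / real (Suc n)" "\<bar>s\<bar> = 1" using s by auto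
      ultimately obtain g \<eta>
        where g: "g \<in> X_space \<alpha>" "X_dist \<alpha> f g < e" "\<eta> > 0"
        "\<And>k. k \<in> X_space \<alpha> \<Longrightarrow> X_dist \<alpha> g k < \<eta> \<Longrightarrow> coverable b (1 / real (Suc n)) s k"
        using coverable_ball_dense[OF assms f, folded b_def] by blast
      have "M.mball g \<eta> \<subseteq> U n s"
        unfolding U_def X_topology_def by (intro interior_of_maximal) (use g(4) in auto)
      moreover have "g \<in> M.mball g \<eta>" using g by simp
      ultimately show "\<exists>y\<in>U n s. y \<in> M.mball f e" using g(1,2) f by auto
    qed
  qed
  define \<G> where "\<G> = (\<lambda>(n, s). U n s) ` (UNIV \<times> {1, - 1})"
  have cG: "countable \<G>" unfolding \<G>_def by (intro countable_image countable_SIGMA) auto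
  have oG: "openin (X_topology \<alpha>) V \<and> X_topology \<alpha> closure_of V = X_space \<alpha>" if "V \<in> \<G>" for V
    using that U dense unfolding \<G>_def by auto
  show ?thesis
  proof (intro exI[of _ "\<Inter>\<G>"] conjI ballI allI impI)
    show "gdelta_in (X_topology \<alpha>) (\<Inter>\<G>)"
      using cG oG by (intro gdelta_in_Inter) (auto simp: \<G>_def intro: open_imp_gdelta_in)
    show "X_topology \<alpha> closure_of \<Inter>\<G> = X_space \<alpha>"
      using M.metric_Baire_category[OF mcomplete_X_space[OF assms(1)] cG] oG
      unfolding X_topology_def by blast
    fix f A and k :: nat
    assume f: "f \<in> \<Inter>\<G>" and A: "A \<subseteq> {0..1}" "convex_restr A f \<or> concave_restr A f" and k: "2 \<le> k"
    have "f \<in> U n s" if "s \<in> {1, - 1}" for n s using f that unfolding \<G>_def by blast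
    then have cov: "coverable b (1 / real (Suc n)) s f" if "s \<in> {1, - 1}" for n s using Us that by blast
    show "hausdorff_dim A \<le> lower_minkowski_dim k A"
      by (rule hausdorff_dim_le_lower_minkowski_dim[OF A(1) k])
    obtain s where "s \<in> {1, - 1}" "convex_restr A (\<lambda>x. s * f x)"
      using A(2) unfolding concave_restr_iff by force
    then show "lower_minkowski_dim k A \<le> ereal (max 0 (\<alpha> - 1))"
      using lower_minkowski_dim_le_of_coverable[OF _ cov A(1) _ k] by (simp add: b_def)
  qed
qed

end
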